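(* Consider the aggregative game with $N$ players, decision sets $\mathcal{X}_i\subset\mathbb{R}^n$ and cost functions $f_i$, and the iteration CP-DNES with weights $w_{ij}$, random compressor $\mathcal{C}$ and step sizes $\alpha_k,\beta_k>0$, all as described in the context. Assume: (i) the communication network is an undirected and connected graph; (ii) for each $i$, $f_i(x_i,h(\mathbf{x}))$ is convex in $x_i$ for every fixed $x_{-i}\in\prod_{j\ne i}\mathcal{X}_j$, and $f_i(x_i,v)$ is continuously differentiable in $(x_i,v)\in\mathcal{X}_i\times\mathbb{R}^n$; (iii) for each $i$, $\phi_i$ is $L_\phi$-Lipschitz continuous, i.e. $\|\phi_i(\mathbf{x})-\phi_i(\mathbf{y})\|\le L_\phi\|\mathbf{x}-\mathbf{y}\|$ for $\mathbf{x},\mathbf{y}\in\mathbb{R}^{Nn}$, and there is $m>0$ such that $(\mathbf{x}-\mathbf{x}^* )^\top(\Phi(\mathbf{x})-\Phi(\mathbf{x}^* ))\ge m\|\mathbf{x}-\mathbf{x}^*\|^2$ for $\mathbf{x}\in\mathbb{R}^{Nn}$, where $\mathbf{x}^*$ is the Nash equilibrium; (iv) for each $i$ and any $x_i\in\mathcal{X}_i$, $\|g_i(x_i,z_1)-g_i(x_i,z_2)\|\le L_g\|z_1-z_2\|$ for all $z_1,z_2\in\mathbb{R}^n$; (v) there is a constant $C>0$ such that $\|g_i\|\le C$ and $\|\phi_i\|\le C$ for all $i$; (vi) for some constant $\sigma$ and any $x\in\mathbb{R}^n$, $\mathbb{E}[\mathcal{C}(x)\mid x]=x$ and $\mathbb{E}[\|\mathcal{C}(x)-x\|^2]\le\sigma^2$,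 and the randomized mechanism in each player's compression is statistically independent. If the step sizes satisfy $$\sum_{k=0}^\infty\alpha_k\beta_k=\infty,\qquad \sum_{k=0}^\infty\alpha_k^2\beta_k<\infty,\qquad \sum_{k=0}^\infty\beta_k^2<\infty,$$ then CP-DNES guarantees that the sequence $\{\mathbf{x}_k\}$ converges to $\mathbf{x}^*$ in mean square, i.e. $$\lim_{k\to\infty}\mathbb{E}\left[\|\mathbf{x}_k-\mathbf{x}^*\|^2\right]=0.$$
   Context: Game. There are $N$ players, $\mathcal{N}=\{1,\dots,N\}$. Player $i$ chooses $x_i\in\mathcal{X}_i$, where $\mathcal{X}_i\subset\mathbb{R}^n$ is a bounded closed convex set; $\mathcal{X}=\prod_{i\in\mathcal{N}}\mathcal{X}_i$, $\mathbf{x}=\mathrm{col}(x_i)_{i\in\mathcal{N}}$ (stacked vector), and $h(\mathbf{x})=\frac1N\sum_{i=1}^N x_i$. Player $i$ minimizes the cost $f_i(x_i,h(\mathbf{x}))$ over $x_i\in\mathcal{X}_i$. A Nash equilibrium is $\mathbf{x}^*=\mathrm{col}(x_i^* )_{i\in\mathcal{N}}\in\mathcal{X}$ such that for every $i$ and every $x_i\in\mathcal{X}_i$, $f_i(x_i^*,\frac1N x_i^*+h(\mathbf{x}_{-i}^* ))\le f_i(x_i,\frac1N x_i+h(\mathbf{x}_{-i}^* ))$, where $h(\mathbf{x}_{-i})=\frac1N\sum_{j\ne i}x_j$. Gradients. $g_i(x_i,z_i)=\left(\nabla_{x_i}f_i(x_i,v)+\frac1N\nabla_v f_i(x_i,v)\right)\big|_{v=z_i}$;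 $\phi_i(\mathbf{x})=\nabla_{x_i}f_i(x_i,h(\mathbf{x}))$ (gradient of the full dependence on $x_i$), so that $\phi_i(\mathbf{x})=g_i(x_i,h(\mathbf{x}))$; $\Phi(\mathbf{x})=\mathrm{col}(\phi_i(\mathbf{x}))_{i\in\mathcal{N}}$. Graph. Players communicate over a graph with weights $w_{ij}$, where $w_{ij}>0$ if player $i$ can receive messages from player $j$ and $w_{ij}=0$ otherwise; $\mathcal{N}_i=\{j: w_{ij}>0\}$. The weights are symmetric, $w_{ij}=w_{ji}$. Algorithm CP-DNES. Given step sizes $\alpha_k,\beta_k>0$, a random compression operator $\mathcal{C}$, and initial values $x_{i,0}\in\mathbb{R}^n$, $y_{i,0}=x_{i,0}$, at each iteration $k=0,1,2,\dots$ every player $i$ computes $\mathcal{C}(y_{i,k})$, sends it to its neighbors, and updates $$x_{i,k+1}=\mathbf{P}_{\mathcal{X}_i}\left[x_{i,k}-\alpha_k\beta_k g_i(x_{i,k},y_{i,k})\right],$$ $$y_{i,k+1}=y_{i,k}+\beta_k\sum_{j\in\mathcal{N}_i}w_{ij}\big(\mathcal{C}(y_{j,k})-\mathcal{C}(y_{i,k})\big)+x_{i,k+1}-x_{i,k},$$ where $\mathbf{P}_{\mathcal{X}_i}$ is Euclidean projection onto $\mathcal{X}_i$. $\mathbf{x}_k=\mathrm{col}(x_{i,k})_{i\in\mathcal{N}}$. $\|\cdot\|$ is the Euclidean norm. *)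

theory Defs
  imports "HOL-Probability.Probability"
begin

text \<open>
  The index type \<open>'p\<close> is the set of players, so the number of players is
  \<open>CARD('p)\<close>.  A profile \<open>x :: (real^'n)^'p\<close> is the stacked vector of all decisions;
  the norm and the inner product of this type are the Euclidean ones of the stacked vector.
\<close>

definition grad :: "('a::real_inner \<Rightarrow> real) \<Rightarrow> 'a \<Rightarrow> 'a" where
  "grad F x = (THE d. GDERIV F x :> d)"

text \<open>Continuous differentiability on a set that need not be open: an ambient derivative
  exists at each point of the set, and the gradient is continuous along the set.\<close>

definition cont_differentiable_on :: "('a::real_inner \<Rightarrow> real) \<Rightarrow> 'a set \<Rightarrow> bool" where
  "cont_differentiable_on F S \<longleftrightarrow>
     (\<forall>p\<in>S. F differentiable (at p)) \<and> continuous_on S (grad F)"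

definition aggregate :: "(real^'n)^'p \<Rightarrow> real^'n" where
  "aggregate x = (1 / real CARD('p)) *\<^sub>R (\<Sum>i\<in>UNIV. x $ i)"

definition aggregate_others :: "'p \<Rightarrow> (real^'n)^'p \<Rightarrow> real^'n" where
  "aggregate_others i x = (1 / real CARD('p)) *\<^sub>R (\<Sum>j\<in>UNIV - {i}. x $ j)"

definition deviate :: "(real^'n)^'p \<Rightarrow> 'p \<Rightarrow> real^'n \<Rightarrow> (real^'n)^'p" where
  "deviate x i u = (\<chi> j. if j = i then u else x $ j)"

definition profiles :: "('p \<Rightarrow> (real^'n) set) \<Rightarrow> ((real^'n)^'p) set" where
  "profiles X = {x. \<forall>i. x $ i \<in> X i}"

definition nash_equilibrium ::
  "('p \<Rightarrow> (real^'n) set) \<Rightarrow> ('p \<Rightarrow> real^'n \<Rightarrow> real^'n \<Rightarrow> real) \<Rightarrow> (real^'n)^'p \<Rightarrow> bool"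
where
  "nash_equilibrium X f xs \<longleftrightarrow> xs \<in> profiles X \<and>
     (\<forall>i. \<forall>u\<in>X i.
        f i (xs $ i) ((1 / real CARD('p)) *\<^sub>R (xs $ i) + aggregate_others i xs)
          \<le> f i u ((1 / real CARD('p)) *\<^sub>R u + aggregate_others i xs))"

definition g_fun ::
  "('p \<Rightarrow> real^'n \<Rightarrow> real^'n \<Rightarrow> real) \<Rightarrow> 'p \<Rightarrow> real^'n \<Rightarrow> real^'n \<Rightarrow> real^'n"
where
  "g_fun f i u z =
     grad (\<lambda>u'. f i u' z) u + (1 / real CARD('p)) *\<^sub>R grad (\<lambda>v. f i u v) z"

definition phi ::
  "('p \<Rightarrow> real^'n \<Rightarrow> real^'n \<Rightarrow> real) \<Rightarrow> 'p \<Rightarrow> (real^'n)^'p \<Rightarrow> real^'n"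
where
  "phi f i x = grad (\<lambda>u. f i u (aggregate (deviate x i u))) (x $ i)"

definition Phi ::
  "('p \<Rightarrow> real^'n \<Rightarrow> real^'n \<Rightarrow> real) \<Rightarrow> (real^'n)^'p \<Rightarrow> (real^'n)^'p"
where
  "Phi f x = (\<chi> i. phi f i x)"

definition nbrs :: "('p \<Rightarrow> 'p \<Rightarrow> real) \<Rightarrow> 'p \<Rightarrow> 'p set" where
  "nbrs w i = {j. w i j > 0}"

definition undirected_weights :: "('p \<Rightarrow> 'p \<Rightarrow> real) \<Rightarrow> bool" where
  "undirected_weights w \<longleftrightarrow> (\<forall>i j. w i j \<ge> 0 \<and> w i j = w j i)"

definition connected_weights :: "('p \<Rightarrow> 'p \<Rightarrow> real) \<Rightarrow> bool" where
  "connected_weights w \<longleftrightarrow> (\<forall>i j. (i, j) \<in> {(a, b). b \<in> nbrs w a}\<^sup>*)"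

text \<open>One trajectory, as the pair of the \<open>x\<close>- and \<open>y\<close>-profiles at each iteration.
  \<open>Q k i\<close> is the realization of the random compressor that player \<open>i\<close> uses in iteration \<open>k\<close>;
  all neighbours of player \<open>i\<close> and player \<open>i\<close> itself see the same message
  \<open>Q k i (y $ i)\<close>.\<close>

primrec cp_dnes ::
  "('p::finite \<Rightarrow> (real^'n) set) \<Rightarrow> ('p \<Rightarrow> real^'n \<Rightarrow> real^'n \<Rightarrow> real) \<Rightarrow> ('p \<Rightarrow> 'p \<Rightarrow> real) \<Rightarrow>
   (nat \<Rightarrow> real) \<Rightarrow> (nat \<Rightarrow> real) \<Rightarrow> (nat \<Rightarrow> 'p \<Rightarrow> real^'n \<Rightarrow> real^'n) \<Rightarrow> (real^'n)^'p \<Rightarrow>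
   nat \<Rightarrow> ((real^'n)^'p) \<times> ((real^'n)^'p)"
where
  "cp_dnes X f w \<alpha> \<beta> Q x0 0 = (x0, x0)"
| "cp_dnes X f w \<alpha> \<beta> Q x0 (Suc k) =
     (let (x, y) = cp_dnes X f w \<alpha> \<beta> Q x0 k;
          x' = (\<chi> i. closest_point (X i) (x $ i - (\<alpha> k * \<beta> k) *\<^sub>R g_fun f i (x $ i) (y $ i)));
          y' = (\<chi> i. y $ i
                 + \<beta> k *\<^sub>R (\<Sum>j\<in>nbrs w i. w i j *\<^sub>R (Q k j (y $ j) - Q k i (y $ i)))
                 + x' $ i - x $ i)
      in (x', y'))"

definition cp_dnes_x ::
  "('p::finite \<Rightarrow> (real^'n) set) \<Rightarrow> ('p \<Rightarrow> real^'n \<Rightarrow> real^'n \<Rightarrow> real) \<Rightarrow> ('p \<Rightarrow> 'p \<Rightarrow> real) \<Rightarrow>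
   (nat \<Rightarrow> real) \<Rightarrow> (nat \<Rightarrow> real) \<Rightarrow> ('r \<Rightarrow> real^'n \<Rightarrow> real^'n) \<Rightarrow> (nat \<Rightarrow> 'p \<Rightarrow> 'w \<Rightarrow> 'r) \<Rightarrow>
   (real^'n)^'p \<Rightarrow> nat \<Rightarrow> 'w \<Rightarrow> (real^'n)^'p"
where
  "cp_dnes_x X f w \<alpha> \<beta> C \<xi> x0 k \<omega> = fst (cp_dnes X f w \<alpha> \<beta> (\<lambda>k i. C (\<xi> k i \<omega>)) x0 k)"

text \<open>A random operator is a jointly measurable function \<open>C r x\<close> of an input \<open>x\<close> and a random
  seed \<open>r\<close>; \<open>\<xi> k i\<close> is the seed drawn by player \<open>i\<close> in iteration \<open>k\<close>.  As the seeds are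
  independent, \<open>\<xi> k i\<close> is independent of the random vector that is compressed with it, so that
  the moment conditions for fixed \<open>x\<close> are the conditional ones given \<open>x\<close>.\<close>

definition unbiased_compression ::
  "'w measure \<Rightarrow> 'r measure \<Rightarrow> ('r \<Rightarrow> real^'n \<Rightarrow> real^'n) \<Rightarrow> (nat \<Rightarrow> 'p \<Rightarrow> 'w \<Rightarrow> 'r) \<Rightarrow> real \<Rightarrow> bool"
where
  "unbiased_compression M R C \<xi> \<sigma> \<longleftrightarrow>
     (\<lambda>(r, x). C r x) \<in> borel_measurable (R \<Otimes>\<^sub>M borel) \<and>
     prob_space.indep_vars M (\<lambda>_. R) (\<lambda>(k, i). \<xi> k i) UNIV \<and>
     (\<forall>k i x.
        integrable M (\<lambda>\<omega>. (norm (C (\<xi> k i \<omega>) x - x))\<^sup>2) \<and>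
        (LINT \<omega>|M. C (\<xi> k i \<omega>) x) = x \<and>
        (LINT \<omega>|M. (norm (C (\<xi> k i \<omega>) x - x))\<^sup>2) \<le> \<sigma>\<^sup>2)"

lemma grad_eqI:
  assumes "GDERIV F x :> d"
  shows "grad F x = d"
proof -
  have "e = d" if "GDERIV F x :> e" for e
  proof -
    have "(\<lambda>h. inner h e) = (\<lambda>h. inner h d)"
      using has_derivative_unique assms that unfolding gderiv_def by blast
    then have "inner (e - d) e = inner (e - d) d"
      by (rule fun_cong)
    then have "inner (e - d) (e - d) = 0"
      by (simp only: inner_diff_right)
    then show ?thesis
      by simp
  qed
  with assms show ?thesis
    unfolding grad_def by blast
qed

lemma aggregate_deviate:
  "aggregate (deviate x i u) = (1 / real CARD('p)) *\<^sub>R u + aggregate_others i x"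
  for x :: "(real^'n)^'p"
proof -
  have "(\<Sum>j\<in>UNIV. deviate x i u $ j) = u + (\<Sum>j\<in>UNIV - {i}. x $ j)"
    by (subst sum.remove[of _ i]) (auto simp: deviate_def intro!: sum.cong)
  then show ?thesis
    by (simp add: aggregate_def aggregate_others_def scaleR_add_right)
qed

lemma differentiable_GDERIV:
  fixes F :: "'a::euclidean_space \<Rightarrow> real"
  assumes "F differentiable (at p)"
  shows "GDERIV F p :> grad F p"
proof -
  obtain F' where F': "(F has_derivative F') (at p)"
    using assms unfolding differentiable_def by blast
  then have "linear F'"
    using has_derivative_linear by blast
  define d where "d = (\<Sum>b\<in>Basis. F' b *\<^sub>R b)"
  have "F' h = inner h d" for h
  proof -
    have "F' h = F' (\<Sum>b\<in>Basis. inner h b *\<^sub>R b)"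
      by (simp add: euclidean_representation)
    also have "\<dots> = (\<Sum>b\<in>Basis. inner h b * F' b)"
      using \<open>linear F'\<close> by (simp add: linear_sum linear_cmul)
    also have "\<dots> = inner h d"
      by (simp add: d_def inner_sum_right mult.commute)
    finally show ?thesis .
  qed
  then have "F' = (\<lambda>h. inner h d)" by blast
  with F' have "GDERIV F p :> d"
    unfolding gderiv_def by simp
  then show ?thesis
    by (simp only: grad_eqI)
qed

lemma phi_eq_g_fun:
  fixes f :: "'p::finite \<Rightarrow> real^'n \<Rightarrow> real^'n \<Rightarrow> real" and x :: "(real^'n)^'p"
  assumes "(\<lambda>(u, v). f i u v) differentiable (at (x $ i, aggregate x))"
  shows "phi f i x = g_fun f i (x $ i) (aggregate x)"
proof -
  let ?F = "\<lambda>(u, v). f i u v" and ?u = "x $ i" and ?v = "aggregate x"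
  let ?c = "1 / real CARD('p)"
  obtain a b where ab: "grad ?F (?u, ?v) = (a, b)"
    by fastforce
  have D: "(?F has_derivative (\<lambda>h. inner h (a, b))) (at (?u, ?v))"
    using differentiable_GDERIV[OF assms] unfolding gderiv_def ab .
  have "deviate x i ?u = x"
    by (simp add: deviate_def vec_eq_iff)
  then have v: "?v = ?c *\<^sub>R ?u + aggregate_others i x"
    by (metis aggregate_deviate)
  have 1: "((\<lambda>u. ?F (u, ?v)) has_derivative (\<lambda>h. inner (h, 0) (a, b))) (at ?u)"
  proof (rule has_derivative_compose[where f = "\<lambda>u. (u, ?v)" and x = ?u and g = ?F, OF _ D])
    show "((\<lambda>u. (u, ?v)) has_derivative (\<lambda>h. (h, 0))) (at ?u)"
      by (intro has_derivative_Pair has_derivative_ident has_derivative_const)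
  qed
  have 2: "((\<lambda>z. ?F (?u, z)) has_derivative (\<lambda>h. inner (0, h) (a, b))) (at ?v)"
  proof (rule has_derivative_compose[where f = "\<lambda>z. (?u, z)" and x = ?v and g = ?F, OF _ D])
    show "((\<lambda>z. (?u, z)) has_derivative (\<lambda>h. (0, h))) (at ?v)"
      by (intro has_derivative_Pair has_derivative_ident has_derivative_const)
  qed
  let ?\<gamma> = "\<lambda>u. (u, ?c *\<^sub>R u + aggregate_others i x)"
  have 3: "((\<lambda>u. ?F (?\<gamma> u)) has_derivative (\<lambda>h. inner (h, ?c *\<^sub>R h + 0) (a, b))) (at ?u)"
  proof (rule has_derivative_compose[where f = ?\<gamma> and x = ?u and g = ?F])
    show "(?\<gamma> has_derivative (\<lambda>h. (h, ?c *\<^sub>R h + 0))) (at ?u)"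
      by (intro has_derivative_Pair has_derivative_ident has_derivative_add
            has_derivative_scaleR_right has_derivative_const)
    show "(?F has_derivative (\<lambda>h. inner h (a, b))) (at (?\<gamma> ?u))"
      using D unfolding v[symmetric] .
  qed
  have "grad (\<lambda>u. f i u ?v) ?u = a" "grad (\<lambda>z. f i ?u z) ?v = b"
    using 1 2 by (auto intro!: grad_eqI simp: gderiv_def)
  moreover have "phi f i x = a + ?c *\<^sub>R b"
    unfolding phi_def aggregate_deviate
    using 3 by (auto intro!: grad_eqI simp: gderiv_def inner_add_right)
  ultimately show ?thesis
    by (simp add: g_fun_def)
qed

end

theory Submission
  imports Defs
begin

text \<open>
  Write \<open>\<delta>\<close> for the disagreement of the estimates, their deviation from the average, which by
  symmetry of the weights is always the average decision. The quantised Laplacian step contracts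
  \<open>\<delta>\<close> by a spectral gap \<open>\<mu>\<close>; the compression errors are orthogonal to the past and of variance at
  most \<open>\<sigma>\<^sup>2\<close>; and a decision moves by at most \<open>O(\<alpha>\<beta>)\<close> per step. Hence
  \<open>E|\<delta>'|\<^sup>2 \<le> (1 - \<mu>\<beta>/2) E|\<delta>|\<^sup>2 + O(\<alpha>\<^sup>2\<beta> + \<beta>\<^sup>2)\<close> for small \<open>\<beta>\<close>, and telescoping yields
  \<open>\<Sum> \<beta> E|\<delta>|\<^sup>2 < \<infinity>\<close>.

  For the distance to the equilibrium, nonexpansiveness of the projection, strong monotonicity and
  the variational inequality at the equilibrium give
  \<open>E|x' - x\<^sup>*|\<^sup>2 \<le> (1 - 2m\<alpha>\<beta>) E|x - x\<^sup>*|\<^sup>2 + O(\<alpha>\<beta> E|\<delta>| + \<alpha>\<^sup>2\<beta>)\<close>. As the decision sets are bounded,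
  the cross term can be split as \<open>2\<alpha>\<beta>|\<delta>| \<le> \<alpha>\<^sup>2\<beta> + \<beta>|\<delta>|\<^sup>2\<close>, which is summable even when \<open>\<alpha>\<close>
  is unbounded; since \<open>\<Sum> \<alpha>\<beta> = \<infinity>\<close>, the second moment tends to zero.
\<close>

section \<open>Almost decreasing sequences\<close>

text \<open>Adding up the step inequality from \<open>K\<close> on telescopes \<open>D\<close>. As
  \<open>D\<close> stays nonnegative, the partial sums of \<open>t\<close> are bounded by
  \<open>D K\<close> plus the tail sum of \<open>\<epsilon>\<close>.\<close>

lemma summable_of_decrease:
  fixes D t \<epsilon> :: "nat \<Rightarrow> real"
  assumes step: "\<And>k. k \<ge> K \<Longrightarrow> D (Suc k) + t k \<le> D k + \<epsilon> k"
    and nonneg: "\<And>k. D k \<ge> 0" "\<And>k. t k \<ge> 0" "\<And>k. \<epsilon> k \<ge> 0"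
    and "summable \<epsilon>"
  shows "summable t"
proof -
  have partial: "D (n + K) + (\<Sum>k<n. t (k + K)) \<le> D K + (\<Sum>k<n. \<epsilon> (k + K))" for n
  proof (induction n)
    case (Suc n)
    then show ?case using step[of "n + K"] by simp
  qed simp
  have "summable (\<lambda>k. \<epsilon> (k + K))"
    using \<open>summable \<epsilon>\<close> by (simp add: summable_iff_shift)
  then have tail: "(\<Sum>k<n. \<epsilon> (k + K)) \<le> suminf (\<lambda>k. \<epsilon> (k + K))" for n
    by (rule sum_le_suminf) (use nonneg in auto)
  have "(\<Sum>k<n. t (k + K)) \<le> D K + suminf (\<lambda>k. \<epsilon> (k + K))" for n
    using partial[of n] nonneg(1)[of "n + K"] tail[of n] by linarith
  then have "summable (\<lambda>k. t (k + K))"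
    by (rule summableI_nonneg_bounded[rotated]) (use nonneg in auto)
  then show ?thesis by (simp add: summable_iff_shift)
qed

text \<open>The products \<open>a k * D k\<close> are summable by the previous lemma, so divergence
  of the sum of \<open>a\<close> forces \<open>D\<close> below any level at arbitrarily late times.
  From such a time on, \<open>D\<close> can climb by at most the tail sum of
  \<open>\<epsilon>\<close>.\<close>

lemma tendsto_zero_of_decrease:
  fixes D a \<epsilon> :: "nat \<Rightarrow> real"
  assumes step: "\<And>k. k \<ge> K \<Longrightarrow> D (Suc k) + a k * D k \<le> D k + \<epsilon> k"
    and nonneg: "\<And>k. D k \<ge> 0" "\<And>k. a k \<ge> 0" "\<And>k. \<epsilon> k \<ge> 0"
    and "summable \<epsilon>" and div: "\<not> summable a"
  shows "D \<longlonglongrightarrow> 0"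
proof (rule LIMSEQ_I)
  fix r :: real assume "r > 0"
  have sum: "summable (\<lambda>k. a k * D k)"
    by (rule summable_of_decrease[where K = K and D = D and \<epsilon> = \<epsilon>]) (use assms in auto)
  obtain N where N: "\<And>n. n \<ge> N \<Longrightarrow> norm (\<Sum>i. \<epsilon> (i + n)) < r / 2"
    using suminf_exist_split[OF _ \<open>summable \<epsilon>\<close>, of "r / 2"] \<open>r > 0\<close> by auto
  \<comment> \<open>A late time at which both \<open>D\<close> and the remaining perturbation are
    below \<open>r / 2\<close>. If there were none, \<open>a\<close> would be dominated by a
    multiple of \<open>a k * D k\<close> and hence summable.\<close>
  obtain n where n: "n \<ge> N" "n \<ge> K" "D n < r / 2"
  proof (rule ccontr)
    assume "\<not> thesis"
    with that have ge: "D n \<ge> r / 2" if "n \<ge> max N K" for n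
      using \<open>n \<ge> max N K\<close> by force
    have "summable (\<lambda>k. (r / 2) * a k)"
    proof (rule summable_comparison_test_ev[OF _ sum])
      show "\<forall>\<^sub>F n in sequentially. norm (r / 2 * a n) \<le> a n * D n"
        using eventually_ge_at_top[of "max N K"]
      proof eventually_elim
        case (elim n)
        have "(r / 2) * a n \<le> D n * a n"
          using ge[OF elim] nonneg(2) by (rule mult_right_mono)
        then show ?case using \<open>r > 0\<close> nonneg(2)[of n] by (simp add: mult.commute abs_mult)
      qed
    qed
    then show False using div \<open>r > 0\<close> by (subst (asm) summable_cmult_iff) auto
  qed
  have step_sum: "D (n + j) \<le> D n + (\<Sum>i<j. \<epsilon> (i + n))" for j
  proof (induction j)
    case (Suc j)
    have "0 \<le> a (n + j) * D (n + j)" using nonneg by simp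
    then show ?case using Suc step[of "n + j"] n by (simp add: add.commute)
  qed simp
  have tail: "(\<Sum>i<j. \<epsilon> (i + n)) \<le> (\<Sum>i. \<epsilon> (i + n))" for j
    by (rule sum_le_suminf) (use nonneg \<open>summable \<epsilon>\<close> in \<open>auto simp: summable_iff_shift\<close>)
  have "(\<Sum>i. \<epsilon> (i + n)) < r / 2"
    using N[OF n(1)] by (simp add: abs_less_iff)
  then have "D (n + j) < r" for j
    using n(3) step_sum[of j] tail[of j] by linarith
  then have "\<forall>k\<ge>n. norm (D k - 0) < r"
    using nonneg(1) by (metis abs_of_nonneg diff_zero le_Suc_ex real_norm_def)
  then show "\<exists>no. \<forall>k\<ge>no. norm (D k - 0) < r" by blast
qed

section \<open>The weighted Laplacian\<close>

text \<open>The negative of the graph Laplacian.\<close>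

definition diffusion :: "('p \<Rightarrow> 'p \<Rightarrow> real) \<Rightarrow> (real^'n)^('p::finite) \<Rightarrow> (real^'n)^'p" where
  "diffusion w y = (\<chi> i. \<Sum>j\<in>UNIV. w i j *\<^sub>R (y $ j - y $ i))"

text \<open>This is the orthogonal projection onto the profiles with zero sum, the complement of the
  consensus profiles.\<close>

definition disagreement :: "(real^'n)^('p::finite) \<Rightarrow> (real^'n)^'p" where
  "disagreement y = (\<chi> i. y $ i - aggregate y)"

lemma aggregate_linear: "linear (aggregate :: (real^'n)^('p::finite) \<Rightarrow> real^'n)"
proof (rule linearI)
  fix x y :: "(real^'n)^'p" and r :: real
  show "aggregate (x + y) = aggregate x + aggregate y"
    by (simp add: aggregate_def sum.distrib scaleR_add_right)
  show "aggregate (r *\<^sub>R x) = r *\<^sub>R aggregate x"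
    unfolding aggregate_def vector_scaleR_component scale_sum_right[symmetric]
    by (simp add: mult.commute)
qed

lemma disagreement_linear: "linear (disagreement :: (real^'n)^('p::finite) \<Rightarrow> (real^'n)^'p)"
  by (rule linearI)
    (simp_all add: disagreement_def vec_eq_iff linear_add[OF aggregate_linear]
      linear_scale[OF aggregate_linear] scaleR_diff_right)

lemma diffusion_linear: "linear (diffusion w)"
  by (rule linearI)
    (simp_all add: diffusion_def vec_eq_iff algebra_simps sum.distrib sum_subtractf sum_distrib_left)

lemma diffusion_disagreement: "diffusion w (disagreement y) = diffusion w y"
  by (simp add: diffusion_def disagreement_def)

lemma sum_disagreement: "(\<Sum>i\<in>UNIV. disagreement y $ i) = 0"
  for y :: "(real^'n)^('p::finite)"
proof -
  have "(\<Sum>i\<in>UNIV. disagreement y $ i) = (\<Sum>i\<in>UNIV. y $ i) - real CARD('p) *\<^sub>R aggregate y"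
    by (simp add: disagreement_def sum_subtractf sum_constant_scaleR del: sum_constant)
  then show ?thesis by (simp add: aggregate_def)
qed

text \<open>Symmetric weights make the flow from i to j cancel the flow from j to i, so
  communication never changes the average of the estimates.\<close>

lemma aggregate_diffusion:
  fixes y :: "(real^'n)^('p::finite)"
  assumes "undirected_weights w"
  shows "aggregate (diffusion w y) = 0"
proof -
  have "(\<Sum>i\<in>UNIV. \<Sum>j\<in>UNIV. w i j *\<^sub>R y $ j) = (\<Sum>i\<in>UNIV. \<Sum>j\<in>UNIV. w j i *\<^sub>R y $ i)"
    by (rule sum.swap)
  also have "\<dots> = (\<Sum>i\<in>UNIV. \<Sum>j\<in>UNIV. w i j *\<^sub>R y $ i)"
    using assms unfolding undirected_weights_def by (intro sum.cong refl) metis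
  finally show ?thesis
    by (simp add: aggregate_def diffusion_def scaleR_diff_right sum_subtractf)
qed

lemma disagreement_diffusion:
  assumes "undirected_weights w"
  shows "disagreement (diffusion w y) = diffusion w y"
  using aggregate_diffusion[OF assms] by (simp add: disagreement_def vec_eq_iff)

text \<open>The Dirichlet form of the graph: add the double sum to its copy with the two indices
  exchanged. Sign and symmetry of the Laplacian can be read off from it.\<close>

lemma inner_diffusion:
  fixes y z :: "(real^'n)^('p::finite)"
  assumes "undirected_weights w"
  shows "2 * (z \<bullet> diffusion w y) =
    - (\<Sum>i\<in>UNIV. \<Sum>j\<in>UNIV. w i j * ((z $ j - z $ i) \<bullet> (y $ j - y $ i)))"
proof -
  have sym: "w i j = w j i" for i j using assms unfolding undirected_weights_def by blast
  have 1: "z \<bullet> diffusion w y = (\<Sum>i\<in>UNIV. \<Sum>j\<in>UNIV. w i j * (z $ i \<bullet> (y $ j - y $ i)))"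
    by (simp add: inner_vec_def[of z] diffusion_def inner_sum_right)
  also have "\<dots> = (\<Sum>j\<in>UNIV. \<Sum>i\<in>UNIV. w i j * (z $ i \<bullet> (y $ j - y $ i)))"
    by (rule sum.swap)
  also have "\<dots> = (\<Sum>i\<in>UNIV. \<Sum>j\<in>UNIV. w i j * (z $ j \<bullet> (y $ i - y $ j)))"
    by (intro sum.cong refl) (metis sym)
  finally have 2: "z \<bullet> diffusion w y = (\<Sum>i\<in>UNIV. \<Sum>j\<in>UNIV. w i j * (z $ j \<bullet> (y $ i - y $ j)))" .
  have "2 * (z \<bullet> diffusion w y) = (\<Sum>i\<in>UNIV. \<Sum>j\<in>UNIV. w i j * (z $ i \<bullet> (y $ j - y $ i)))
      + (\<Sum>i\<in>UNIV. \<Sum>j\<in>UNIV. w i j * (z $ j \<bullet> (y $ i - y $ j)))"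
    using 1 2 by simp
  also have "\<dots> = - (\<Sum>i\<in>UNIV. \<Sum>j\<in>UNIV. w i j * ((z $ j - z $ i) \<bullet> (y $ j - y $ i)))"
    unfolding sum.distrib[symmetric] sum_negf[symmetric]
    by (intro sum.cong refl) (simp add: algebra_simps)
  finally show ?thesis .
qed

lemma diffusion_symmetric:
  assumes "undirected_weights w"
  shows "z \<bullet> diffusion w y = diffusion w z \<bullet> y"
proof -
  have "2 * (z \<bullet> diffusion w y) = 2 * (y \<bullet> diffusion w z)"
    unfolding inner_diffusion[OF assms] by (simp add: inner_commute)
  then show ?thesis by (simp add: inner_commute)
qed

text \<open>All terms of the Dirichlet form are nonnegative, so each one vanishes. The values then
  agree across every edge, and connectedness carries the equality along paths.\<close>

lemma consensus_of_diffusion_zero: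
  fixes y :: "(real^'n)^('p::finite)"
  assumes w: "undirected_weights w" "connected_weights w" and zero: "y \<bullet> diffusion w y = 0"
  shows "y $ i = y $ j"
proof -
  have nonneg: "0 \<le> w i j * ((y $ j - y $ i) \<bullet> (y $ j - y $ i))" for i j
    using w(1) by (simp add: undirected_weights_def)
  have "(\<Sum>i\<in>UNIV. \<Sum>j\<in>UNIV. w i j * ((y $ j - y $ i) \<bullet> (y $ j - y $ i))) = 0"
    using inner_diffusion[OF w(1), of y y] zero by simp
  then have "w i j * ((y $ j - y $ i) \<bullet> (y $ j - y $ i)) = 0" for i j
    using nonneg by (simp add: sum_nonneg_eq_0_iff sum_nonneg)
  then have edge: "y $ i = y $ j" if "j \<in> nbrs w i" for i j
    using that unfolding nbrs_def by (metis eq_iff_diff_eq_0 inner_eq_zero_iff less_irrefl mem_Collect_eq mult_eq_0_iff)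
  have "(i, j) \<in> {(a, b). b \<in> nbrs w a}\<^sup>*"
    using w(2) unfolding connected_weights_def by blast
  then show ?thesis
    by (induction rule: rtrancl_induct) (use edge in auto)
qed

text \<open>Compactness argument: on the unit sphere of the zero-sum profiles the quadratic form is
  continuous and negative, so its maximum is negative. Homogeneity of degree two extends the bound
  to all zero-sum profiles.\<close>

lemma spectral_gap:
  assumes w: "undirected_weights w" "connected_weights w"
  obtains \<mu> :: real where "\<mu> > 0"
    "\<And>y :: (real^'n)^('p::finite). (\<Sum>i\<in>UNIV. y $ i) = 0 \<Longrightarrow> y \<bullet> diffusion w y \<le> - \<mu> * (norm y)\<^sup>2"
proof -
  define S where "S = {y :: (real^'n)^'p. (\<Sum>i\<in>UNIV. y $ i) = 0} \<inter> sphere 0 1"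
  have "compact S" unfolding S_def
    by (intro closed_Int_compact compact_sphere closed_Collect_eq continuous_intros)
  have cont: "continuous_on S (\<lambda>y. y \<bullet> diffusion w y)"
    by (intro continuous_on_inner continuous_on_id linear_continuous_on linear_conv_bounded_linear[THEN iffD1] diffusion_linear)
  have neg: "y \<bullet> diffusion w y < 0" if "y \<in> S" for y
  proof -
    have "0 \<le> (\<Sum>i\<in>UNIV. \<Sum>j\<in>UNIV. w i j * ((y $ j - y $ i) \<bullet> (y $ j - y $ i)))"
      using w(1) by (intro sum_nonneg) (simp add: undirected_weights_def)
    then have "y \<bullet> diffusion w y \<le> 0"
      using inner_diffusion[OF w(1), of y y] by linarith
    moreover have "y \<bullet> diffusion w y \<noteq> 0"
    proof
      assume "y \<bullet> diffusion w y = 0"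
      then have eq: "y $ j = y $ i" for i j
        using consensus_of_diffusion_zero[OF w] by blast
      \<comment> \<open>A consensus profile with zero sum is zero, which the unit sphere
        excludes.\<close>
      have "(\<Sum>j\<in>UNIV. y $ j) = (\<Sum>j\<in>(UNIV :: 'p set). y $ i)" for i
        by (rule sum.cong) (use eq in auto)
      with that have "real CARD('p) *\<^sub>R y $ i = 0" for i
        unfolding S_def by (simp add: sum_constant_scaleR del: sum_constant)
      then have "y = 0" by (simp add: vec_eq_iff[where 'b = 'p])
      with that show False unfolding S_def by simp
    qed
    ultimately show ?thesis by simp
  qed
  obtain \<mu> where \<mu>: "\<mu> > 0" "\<And>y. y \<in> S \<Longrightarrow> y \<bullet> diffusion w y \<le> - \<mu>"
  proof (cases "S = {}")
    \<comment> \<open>This happens for a single player, whose only zero-sum profile is 0; any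
      positive gap will do.\<close>
    case True then show ?thesis using that[of 1] by auto
  next
    case False
    then obtain y where "y \<in> S" "\<forall>z\<in>S. z \<bullet> diffusion w z \<le> y \<bullet> diffusion w y"
      using continuous_attains_sup[OF \<open>compact S\<close> _ cont] by blast
    then show ?thesis using that[of "- (y \<bullet> diffusion w y)"] neg by auto
  qed
  show ?thesis
  proof (rule that[OF \<mu>(1)])
    fix y :: "(real^'n)^'p" assume y: "(\<Sum>i\<in>UNIV. y $ i) = 0"
    show "y \<bullet> diffusion w y \<le> - \<mu> * (norm y)\<^sup>2"
    proof (cases "y = 0")
      case False
      define z where "z = inverse (norm y) *\<^sub>R y"
      have "z \<in> S" using y False by (simp add: S_def z_def flip: scaleR_right.sum)
      then have "z \<bullet> diffusion w z \<le> - \<mu>" by (rule \<mu>(2))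
      moreover have "y \<bullet> diffusion w y = (norm y)\<^sup>2 * (z \<bullet> diffusion w z)"
        using False by (simp add: z_def linear_scale[OF diffusion_linear] power2_eq_square field_simps)
      ultimately show ?thesis
        using mult_left_mono[of "z \<bullet> diffusion w z" "- \<mu>" "(norm y)\<^sup>2"] by (simp add: mult.commute)
    qed simp
  qed
qed

section \<open>Equilibrium and gradients\<close>

text \<open>First-order optimality on a convex set: a negative directional derivative towards
  \<open>u\<close> would make the cost drop on a short piece of the segment from
  \<open>xs $ i\<close> to \<open>u\<close>, which stays inside \<open>X i\<close>.\<close>

lemma nash_variational:
  fixes f :: "'p::finite \<Rightarrow> real^'n \<Rightarrow> real^'n \<Rightarrow> real"
  assumes nash: "nash_equilibrium X f xs" and "convex (X i)"
    and diff: "(\<lambda>(u, v). f i u v) differentiable (at (xs $ i, aggregate xs))"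
    and u: "u \<in> X i"
  shows "(u - xs $ i) \<bullet> phi f i xs \<ge> 0"
proof (rule ccontr)
  let ?c = "1 / real CARD('p)"
  let ?\<gamma> = "\<lambda>u. (u, ?c *\<^sub>R u + aggregate_others i xs)"
  \<comment> \<open>The cost of player i as a function of its own decision alone, including its
    effect on the aggregate; its gradient at \<open>xs $ i\<close> is therefore
    \<open>phi f i xs\<close>.\<close>
  define F where "F u = (\<lambda>(u, v). f i u v) (?\<gamma> u)" for u
  assume neg: "\<not> ?thesis"
  have "deviate xs i (xs $ i) = xs"
    by (simp add: deviate_def vec_eq_iff)
  then have v: "aggregate xs = ?c *\<^sub>R xs $ i + aggregate_others i xs"
    by (metis aggregate_deviate)
  have "?\<gamma> differentiable (at (xs $ i))"
    by (rule differentiableI[of _ "\<lambda>h. (h, ?c *\<^sub>R h + 0)"])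
      (intro has_derivative_Pair has_derivative_ident has_derivative_add
            has_derivative_scaleR_right has_derivative_const)
  then have "F differentiable (at (xs $ i))"
    unfolding F_def using differentiable_compose[of "\<lambda>(u, v). f i u v" ?\<gamma> "xs $ i" UNIV] diff v by simp
  then have "GDERIV F (xs $ i) :> grad F (xs $ i)" by (rule differentiable_GDERIV)
  moreover have "grad F (xs $ i) = phi f i xs"
    unfolding phi_def aggregate_deviate F_def by simp
  ultimately have F: "(F has_derivative (\<lambda>h. h \<bullet> phi f i xs)) (at (xs $ i))"
    by (simp add: gderiv_def)
  let ?l = "\<lambda>t::real. xs $ i + t *\<^sub>R (u - xs $ i)"
  have l: "(?l has_derivative (\<lambda>t. 0 + t *\<^sub>R (u - xs $ i))) (at 0)"
    by (intro has_derivative_add has_derivative_const has_derivative_scaleR_left has_derivative_ident)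
  have F0: "(F has_derivative (\<lambda>h. h \<bullet> phi f i xs)) (at (?l 0))" using F by simp
  have "((\<lambda>t. F (?l t)) has_derivative (\<lambda>t. (0 + t *\<^sub>R (u - xs $ i)) \<bullet> phi f i xs)) (at 0)"
    using has_derivative_compose[OF l F0] .
  moreover have "(\<lambda>t. (0 + t *\<^sub>R (u - xs $ i)) \<bullet> phi f i xs) = (*) ((u - xs $ i) \<bullet> phi f i xs)"
    by (rule ext) (simp add: mult.commute)
  ultimately have "DERIV (\<lambda>t. F (?l t)) 0 :> (u - xs $ i) \<bullet> phi f i xs"
    by (simp only: has_field_derivative_def)
  from DERIV_neg_dec_right[OF this] neg obtain d
    where d: "d > 0" "\<And>h. 0 < h \<Longrightarrow> h < d \<Longrightarrow> F (?l h) < F (xs $ i)" by auto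
  \<comment> \<open>At most 1 so that the point lies on the segment, and below \<open>d\<close> so
    that the cost has strictly decreased there.\<close>
  define h where "h = min 1 (d / 2)"
  have h: "0 < h" "h < d" "h \<le> 1" using d(1) by (auto simp: h_def)
  have "xs $ i \<in> X i" using nash unfolding nash_equilibrium_def profiles_def by blast
  then have "(1 - h) *\<^sub>R xs $ i + h *\<^sub>R u \<in> X i"
    using \<open>convex (X i)\<close> u h by (intro convexD) auto
  then have "?l h \<in> X i" by (simp add: algebra_simps)
  then have "F (xs $ i) \<le> F (?l h)"
    using nash unfolding nash_equilibrium_def F_def by auto
  with d(2)[OF h(1,2)] show False by simp
qed

text \<open>Both partial gradients are components of the joint gradient, so \<open>g_fun\<close>
  inherits its continuity. This is what makes the updates measurable later.\<close>

lemma g_fun_continuous_on: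
  fixes f :: "'p::finite \<Rightarrow> real^'n \<Rightarrow> real^'n \<Rightarrow> real"
  assumes "cont_differentiable_on (\<lambda>(u, v). f i u v) S"
  shows "continuous_on S (\<lambda>(u, z). g_fun f i u z)"
proof -
  let ?F = "\<lambda>(u, v). f i u v"
  let ?G = "\<lambda>p. fst (grad ?F p) + (1 / real CARD('p)) *\<^sub>R snd (grad ?F p)"
  have "g_fun f i u z = ?G (u, z)" if "(u, z) \<in> S" for u z
  proof -
    obtain a b where ab: "grad ?F (u, z) = (a, b)" by fastforce
    have "?F differentiable (at (u, z))"
      using assms that unfolding cont_differentiable_on_def by blast
    then have D: "(?F has_derivative (\<lambda>h. h \<bullet> (a, b))) (at (u, z))"
      using differentiable_GDERIV ab unfolding gderiv_def by metis
    have "((\<lambda>u. (u, z)) has_derivative (\<lambda>h. (h, 0))) (at u)"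
      by (intro has_derivative_Pair has_derivative_ident has_derivative_const)
    from has_derivative_compose[OF this D]
    have "grad (\<lambda>u'. f i u' z) u = a" by (auto intro!: grad_eqI simp: gderiv_def)
    moreover have "((\<lambda>z. (u, z)) has_derivative (\<lambda>h. (0, h))) (at z)"
      by (intro has_derivative_Pair has_derivative_ident has_derivative_const)
    from has_derivative_compose[OF this D]
    have "grad (\<lambda>v. f i u v) z = b" by (auto intro!: grad_eqI simp: gderiv_def)
    ultimately show ?thesis by (simp add: g_fun_def ab)
  qed
  moreover have "continuous_on S ?G"
    using assms unfolding cont_differentiable_on_def by (intro continuous_intros) auto
  ultimately show ?thesis
    by (subst continuous_on_cong[OF refl, where g = ?G]) auto
qed

section \<open>Square-integrable vectors and compression errors\<close>

lemma borel_measurable_vec_lambda: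
  fixes F :: "'i::finite \<Rightarrow> 'a \<Rightarrow> 'b::euclidean_space"
  assumes "\<And>i. F i \<in> borel_measurable N"
  shows "(\<lambda>x. \<chi> i. F i x) \<in> borel_measurable N"
  unfolding borel_measurable_euclidean_space[where f = "\<lambda>x. \<chi> i. F i x"]
  using assms by (auto simp: Basis_vec_def inner_axis intro!: borel_measurable_inner)

lemma borel_measurable_vec_nth [measurable (raw)]:
  fixes F :: "'a \<Rightarrow> 'b::euclidean_space^'i"
  assumes "F \<in> borel_measurable N"
  shows "(\<lambda>x. F x $ i) \<in> borel_measurable N"
  by (rule measurable_compose[OF assms borel_measurable_continuous_onI]) (intro continuous_intros)

lemma borel_measurable_linear:
  fixes h :: "'b::euclidean_space \<Rightarrow> 'c::euclidean_space"
  assumes "linear h" "F \<in> borel_measurable N"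
  shows "(\<lambda>x. h (F x)) \<in> borel_measurable N"
  using assms by (intro measurable_compose[OF assms(2) borel_measurable_continuous_onI]
      linear_continuous_on) (simp add: linear_conv_bounded_linear)

lemma norm_vec_le_sum: "norm x \<le> (\<Sum>i\<in>UNIV. norm (x $ i))"
  by (simp add: norm_vec_def L2_set_le_sum)

lemma power2_norm_vec: "(norm x)\<^sup>2 = (\<Sum>i\<in>UNIV. (norm (x $ i))\<^sup>2)"
  for x :: "'b::real_inner^'i"
  by (simp add: power2_norm_eq_inner inner_vec_def)

lemma power2_norm_add_le: "(norm (x + y))\<^sup>2 \<le> 2 * (norm x)\<^sup>2 + 2 * (norm y)\<^sup>2"
  for x y :: "'b::real_normed_vector"
proof -
  have "(norm (x + y))\<^sup>2 \<le> (norm x + norm y)\<^sup>2"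
    by (intro power_mono norm_triangle_ineq) simp
  also have "\<dots> \<le> 2 * (norm x)\<^sup>2 + 2 * (norm y)\<^sup>2"
    using sum_squares_bound[of "norm x" "norm y"] by (simp add: power2_sum)
  finally show ?thesis .
qed

lemma square_integrable_add:
  fixes F G :: "'a \<Rightarrow> 'b::euclidean_space"
  assumes [measurable]: "F \<in> borel_measurable M" "G \<in> borel_measurable M"
    and int: "integrable M (\<lambda>\<omega>. (norm (F \<omega>))\<^sup>2)" "integrable M (\<lambda>\<omega>. (norm (G \<omega>))\<^sup>2)"
  shows "integrable M (\<lambda>\<omega>. (norm (F \<omega> + G \<omega>))\<^sup>2)"
proof (rule Bochner_Integration.integrable_bound)
  show "integrable M (\<lambda>\<omega>. 2 * (norm (F \<omega>))\<^sup>2 + 2 * (norm (G \<omega>))\<^sup>2)"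
    using int by simp
  show "AE \<omega> in M. norm ((norm (F \<omega> + G \<omega>))\<^sup>2) \<le> norm (2 * (norm (F \<omega>))\<^sup>2 + 2 * (norm (G \<omega>))\<^sup>2)"
    using power2_norm_add_le by (intro AE_I2) auto
qed measurable

lemma square_integrable_linear:
  fixes h :: "'b::euclidean_space \<Rightarrow> 'c::euclidean_space"
  assumes h: "linear h" and F: "F \<in> borel_measurable M"
    and int: "integrable M (\<lambda>\<omega>. (norm (F \<omega>))\<^sup>2)"
  shows "integrable M (\<lambda>\<omega>. (norm (h (F \<omega>)))\<^sup>2)"
proof -
  obtain K where K: "\<And>v. norm (h v) \<le> K * norm v" using linear_bounded_pos[OF h] by blast
  have [measurable]: "(\<lambda>\<omega>. h (F \<omega>)) \<in> borel_measurable M"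
    by (rule borel_measurable_linear) fact+
  have le: "(norm (h v))\<^sup>2 \<le> K\<^sup>2 * (norm v)\<^sup>2" for v
    using power_mono[OF K[of v] norm_ge_zero, of 2] by (simp add: power_mult_distrib)
  show ?thesis
  proof (rule Bochner_Integration.integrable_bound)
    show "integrable M (\<lambda>\<omega>. K\<^sup>2 * (norm (F \<omega>))\<^sup>2)" using int by simp
    show "AE \<omega> in M. norm ((norm (h (F \<omega>)))\<^sup>2) \<le> norm (K\<^sup>2 * (norm (F \<omega>))\<^sup>2)"
      using le by (intro AE_I2) auto
  qed measurable
qed

text \<open>Independence makes the joint law of \<open>P\<close> and \<open>\<xi>\<close> a product.
  By Fubini the input \<open>Y (P \<omega>)\<close> can be frozen while the seed is averaged out, so
  the moment conditions for fixed inputs carry over to inputs that depend on the past.\<close>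

lemma (in prob_space) compression_error:
  fixes C :: "'r \<Rightarrow> 'v::euclidean_space \<Rightarrow> 'v"
  assumes ind: "indep_var S P R \<xi>"
    and C: "(\<lambda>(r, x). C r x) \<in> borel_measurable (R \<Otimes>\<^sub>M borel)"
    and int: "\<And>x. integrable M (\<lambda>\<omega>. (norm (C (\<xi> \<omega>) x - x))\<^sup>2)"
    and mean: "\<And>x. (LINT \<omega>|M. C (\<xi> \<omega>) x) = x"
    and var: "\<And>x. (LINT \<omega>|M. (norm (C (\<xi> \<omega>) x - x))\<^sup>2) \<le> v"
    and Y: "Y \<in> borel_measurable S"
  shows compression_error_integrable: "integrable M (\<lambda>\<omega>. (norm (C (\<xi> \<omega>) (Y (P \<omega>)) - Y (P \<omega>)))\<^sup>2)"
    and compression_error_variance: "(LINT \<omega>|M. (norm (C (\<xi> \<omega>) (Y (P \<omega>)) - Y (P \<omega>)))\<^sup>2) \<le> v"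
    and compression_error_orthogonal:
      "Z \<in> borel_measurable S \<Longrightarrow> integrable M (\<lambda>\<omega>. (norm (Z (P \<omega>)))\<^sup>2) \<Longrightarrow>
        integrable M (\<lambda>\<omega>. Z (P \<omega>) \<bullet> (C (\<xi> \<omega>) (Y (P \<omega>)) - Y (P \<omega>))) \<and>
        (LINT \<omega>|M. Z (P \<omega>) \<bullet> (C (\<xi> \<omega>) (Y (P \<omega>)) - Y (P \<omega>))) = 0"
proof -
  have rv[measurable]: "random_variable S P" "random_variable R \<xi>"
    and joint: "distr M S P \<Otimes>\<^sub>M distr M R \<xi> = distr M (S \<Otimes>\<^sub>M R) (\<lambda>\<omega>. (P \<omega>, \<xi> \<omega>))"
    using ind unfolding indep_var_distribution_eq by auto
  interpret A: prob_space "distr M S P" by (rule prob_space_distr[OF rv(1)])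
  interpret B: prob_space "distr M R \<xi>" by (rule prob_space_distr[OF rv(2)])
  interpret AB: pair_prob_space "distr M S P" "distr M R \<xi>" ..
  note Y[measurable]
  have [measurable]: "(\<lambda>p. C (fst p) (snd p)) \<in> borel_measurable (R \<Otimes>\<^sub>M borel)"
    using C by (simp add: case_prod_beta')
  have err[measurable]: "(\<lambda>p. C (snd p) (Y (fst p)) - Y (fst p)) \<in> borel_measurable (S \<Otimes>\<^sub>M R)"
    using measurable_compose[of "\<lambda>p. (snd p, Y (fst p))" "S \<Otimes>\<^sub>M R" _ "\<lambda>p. C (fst p) (snd p)"]
    by simp
  have Cx[measurable]: "(\<lambda>r. C r x) \<in> borel_measurable R" for x
    using measurable_compose[of "\<lambda>r. (r, x)" R "R \<Otimes>\<^sub>M borel" "\<lambda>p. C (fst p) (snd p)"] by simp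
  have "v \<ge> 0"
    by (rule order_trans[OF _ var[of 0]]) simp
  \<comment> \<open>Integrability is still open here, so the bound is first derived for the
    nonnegative integral, where Tonelli needs only measurability.\<close>
  have "(\<integral>\<^sup>+\<omega>. ennreal ((norm (C (\<xi> \<omega>) (Y (P \<omega>)) - Y (P \<omega>)))\<^sup>2) \<partial>M)
      = (\<integral>\<^sup>+p. ennreal ((norm (C (snd p) (Y (fst p)) - Y (fst p)))\<^sup>2) \<partial>distr M (S \<Otimes>\<^sub>M R) (\<lambda>\<omega>. (P \<omega>, \<xi> \<omega>)))"
    by (subst nn_integral_distr) auto
  also have "\<dots> = (\<integral>\<^sup>+s. \<integral>\<^sup>+r. ennreal ((norm (C r (Y s) - Y s))\<^sup>2) \<partial>distr M R \<xi> \<partial>distr M S P)"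
    unfolding joint[symmetric] by (subst B.nn_integral_fst[symmetric]) auto
  also have "\<dots> \<le> (\<integral>\<^sup>+s. ennreal v \<partial>distr M S P)"
  proof (rule nn_integral_mono)
    fix s
    have "(\<integral>\<^sup>+r. ennreal ((norm (C r (Y s) - Y s))\<^sup>2) \<partial>distr M R \<xi>)
        = (\<integral>\<^sup>+\<omega>. ennreal ((norm (C (\<xi> \<omega>) (Y s) - Y s))\<^sup>2) \<partial>M)"
      by (subst nn_integral_distr) auto
    also have "\<dots> \<le> ennreal v"
      using var by (subst nn_integral_eq_integral[OF int]) (auto intro: ennreal_leI)
    finally show "(\<integral>\<^sup>+r. ennreal ((norm (C r (Y s) - Y s))\<^sup>2) \<partial>distr M R \<xi>) \<le> ennreal v" .
  qed
  also have "\<dots> = ennreal v"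
    using A.emeasure_space_1 by simp
  finally have le: "(\<integral>\<^sup>+\<omega>. ennreal ((norm (C (\<xi> \<omega>) (Y (P \<omega>)) - Y (P \<omega>)))\<^sup>2) \<partial>M) \<le> ennreal v" .
  have errM[measurable]: "(\<lambda>\<omega>. C (\<xi> \<omega>) (Y (P \<omega>)) - Y (P \<omega>)) \<in> borel_measurable M"
    using measurable_compose[of "\<lambda>\<omega>. (P \<omega>, \<xi> \<omega>)" M _ "\<lambda>p. C (snd p) (Y (fst p)) - Y (fst p)", OF _ err] by simp
  show integrable: "integrable M (\<lambda>\<omega>. (norm (C (\<xi> \<omega>) (Y (P \<omega>)) - Y (P \<omega>)))\<^sup>2)"
    using le by (intro integrableI_nonneg) (auto intro: le_less_trans)
  show "(LINT \<omega>|M. (norm (C (\<xi> \<omega>) (Y (P \<omega>)) - Y (P \<omega>)))\<^sup>2) \<le> v"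
    using le \<open>v \<ge> 0\<close> by (subst (asm) nn_integral_eq_integral[OF integrable]) (auto simp: ennreal_le_iff)
  assume Z[measurable]: "Z \<in> borel_measurable S" and Z2: "integrable M (\<lambda>\<omega>. (norm (Z (P \<omega>)))\<^sup>2)"
  let ?h = "\<lambda>p. Z (fst p) \<bullet> (C (snd p) (Y (fst p)) - Y (fst p))"
  have h[measurable]: "?h \<in> borel_measurable (S \<Otimes>\<^sub>M R)" by measurable
  \<comment> \<open>The sum of squares dominates the inner product by Cauchy-Schwarz; this
    integrability is what Fubini requires below.\<close>
  have "integrable M (\<lambda>\<omega>. (norm (Z (P \<omega>)))\<^sup>2 + (norm (C (\<xi> \<omega>) (Y (P \<omega>)) - Y (P \<omega>)))\<^sup>2)"
    using Z2 integrable by simp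
  then have int_h: "integrable M (\<lambda>\<omega>. Z (P \<omega>) \<bullet> (C (\<xi> \<omega>) (Y (P \<omega>)) - Y (P \<omega>)))"
  proof (rule Bochner_Integration.integrable_bound)
    show "AE \<omega> in M. norm (Z (P \<omega>) \<bullet> (C (\<xi> \<omega>) (Y (P \<omega>)) - Y (P \<omega>)))
        \<le> norm ((norm (Z (P \<omega>)))\<^sup>2 + (norm (C (\<xi> \<omega>) (Y (P \<omega>)) - Y (P \<omega>)))\<^sup>2)"
    proof (rule AE_I2)
      fix \<omega>
      let ?z = "Z (P \<omega>)" and ?e = "C (\<xi> \<omega>) (Y (P \<omega>)) - Y (P \<omega>)"
      have "\<bar>?z \<bullet> ?e\<bar> \<le> norm ?z * norm ?e" by (rule Cauchy_Schwarz_ineq2)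
      also have "\<dots> \<le> (norm ?z)\<^sup>2 + (norm ?e)\<^sup>2"
        using sum_squares_bound[of "norm ?z" "norm ?e"] mult_nonneg_nonneg[OF norm_ge_zero norm_ge_zero, of ?z ?e]
        by linarith
      finally show "norm (?z \<bullet> ?e) \<le> norm ((norm ?z)\<^sup>2 + (norm ?e)\<^sup>2)" by simp
    qed
  qed measurable
  have int_pair: "integrable (distr M S P \<Otimes>\<^sub>M distr M R \<xi>) ?h"
    unfolding joint using int_h by (subst integrable_distr_eq) auto
  have "(LINT \<omega>|M. Z (P \<omega>) \<bullet> (C (\<xi> \<omega>) (Y (P \<omega>)) - Y (P \<omega>)))
      = integral\<^sup>L (distr M S P \<Otimes>\<^sub>M distr M R \<xi>) ?h"
    unfolding joint by (subst integral_distr) auto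
  also have "\<dots> = (LINT s|distr M S P. LINT r|distr M R \<xi>. Z s \<bullet> (C r (Y s) - Y s))"
    using AB.integral_fst'[OF int_pair] by simp
  also have "\<dots> = (LINT s|distr M S P. 0)"
  proof (rule Bochner_Integration.integral_cong[OF refl])
    fix s
    \<comment> \<open>On a probability space square integrability gives integrability, so for a
      frozen \<open>s\<close> the mean passes through the inner product and the centred error
      averages to zero.\<close>
    have sq: "integrable M (\<lambda>\<omega>. norm (C (\<xi> \<omega>) (Y s) - Y s))"
      by (rule square_integrable_imp_integrable) (use int in auto)
    then have e: "integrable M (\<lambda>\<omega>. C (\<xi> \<omega>) (Y s) - Y s)"
      by (subst (asm) integrable_norm_iff) auto
    then have "integrable M (\<lambda>\<omega>. (C (\<xi> \<omega>) (Y s) - Y s) + Y s)"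
      by (intro Bochner_Integration.integrable_add) auto
    then have c: "integrable M (\<lambda>\<omega>. C (\<xi> \<omega>) (Y s))" by simp
    have "(LINT r|distr M R \<xi>. Z s \<bullet> (C r (Y s) - Y s)) = (LINT \<omega>|M. Z s \<bullet> (C (\<xi> \<omega>) (Y s) - Y s))"
      by (subst integral_distr) auto
    also have "\<dots> = Z s \<bullet> (LINT \<omega>|M. C (\<xi> \<omega>) (Y s) - Y s)"
      using e by (rule integral_inner_right)
    also have "(LINT \<omega>|M. C (\<xi> \<omega>) (Y s) - Y s) = 0"
      using c mean by (subst Bochner_Integration.integral_diff) (auto simp: prob_space)
    finally show "(LINT r|distr M R \<xi>. Z s \<bullet> (C r (Y s) - Y s)) = 0" by simp
  qed
  finally show "integrable M (\<lambda>\<omega>. Z (P \<omega>) \<bullet> (C (\<xi> \<omega>) (Y (P \<omega>)) - Y (P \<omega>))) \<and>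
      (LINT \<omega>|M. Z (P \<omega>) \<bullet> (C (\<xi> \<omega>) (Y (P \<omega>)) - Y (P \<omega>))) = 0"
    using int_h by simp
qed

section \<open>The stochastic iteration\<close>

locale cp_dnes_run = prob_space M
  for M :: "'w measure" +
  fixes X :: "'p::finite \<Rightarrow> (real^'n) set"
    and f :: "'p \<Rightarrow> real^'n \<Rightarrow> real^'n \<Rightarrow> real"
    and w :: "'p \<Rightarrow> 'p \<Rightarrow> real"
    and \<alpha> \<beta> :: "nat \<Rightarrow> real"
    and x0 xs :: "(real^'n)^'p"
    and R :: "'r measure"
    and C :: "'r \<Rightarrow> real^'n \<Rightarrow> real^'n"
    and \<xi> :: "nat \<Rightarrow> 'p \<Rightarrow> 'w \<Rightarrow> 'r"
    and L\<^sub>g m B \<sigma> :: real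
  assumes X: "\<And>i. bounded (X i) \<and> closed (X i) \<and> convex (X i)"
    and graph: "undirected_weights w" "connected_weights w"
    and f_C1: "\<And>i. cont_differentiable_on (\<lambda>(u, v). f i u v) (X i \<times> UNIV)"
    and xs: "nash_equilibrium X f xs"
    and m: "m > 0"
    and strong_mono: "\<And>x. (x - xs) \<bullet> (Phi f x - Phi f xs) \<ge> m * (norm (x - xs))\<^sup>2"
    and g_Lipschitz: "\<And>i u z1 z2. u \<in> X i \<Longrightarrow>
          norm (g_fun f i u z1 - g_fun f i u z2) \<le> L\<^sub>g * norm (z1 - z2)"
    and g_bound: "\<And>i u z. u \<in> X i \<Longrightarrow> norm (g_fun f i u z) \<le> B"
    and compression: "unbiased_compression M R C \<xi> \<sigma>"
    and step_pos: "\<And>k. \<alpha> k > 0" "\<And>k. \<beta> k > 0"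
    and step_div: "filterlim (\<lambda>n. \<Sum>k<n. \<alpha> k * \<beta> k) at_top sequentially"
    and step_sum: "summable (\<lambda>k. (\<alpha> k)\<^sup>2 * \<beta> k)" "summable (\<lambda>k. (\<beta> k)\<^sup>2)"
begin

text \<open>The iterates are studied as deterministic functions of the family of all seeds; those of
  iteration \<open>k\<close> only read the seeds of the iterations before \<open>k\<close>, and \<open>decision (Suc k)\<close> does not
  read the seeds of iteration \<open>k\<close> either.\<close>

definition state :: "nat \<Rightarrow> (nat \<times> 'p \<Rightarrow> 'r) \<Rightarrow> ((real^'n)^'p) \<times> ((real^'n)^'p)" where
  "state k s = cp_dnes X f w \<alpha> \<beta> (\<lambda>l i. C (s (l, i))) x0 k"

definition decision :: "nat \<Rightarrow> (nat \<times> 'p \<Rightarrow> 'r) \<Rightarrow> (real^'n)^'p" where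
  "decision k s = fst (state k s)"

definition estimate :: "nat \<Rightarrow> (nat \<times> 'p \<Rightarrow> 'r) \<Rightarrow> (real^'n)^'p" where
  "estimate k s = snd (state k s)"

definition seeds :: "'w \<Rightarrow> nat \<times> 'p \<Rightarrow> 'r" where
  "seeds \<omega> = (\<lambda>(l, i). \<xi> l i \<omega>)"

definition past :: "nat \<Rightarrow> 'w \<Rightarrow> nat \<times> 'p \<Rightarrow> 'r" where
  "past k \<omega> = restrict (seeds \<omega>) ({..<k} \<times> UNIV)"

definition noise :: "nat \<Rightarrow> (nat \<times> 'p \<Rightarrow> 'r) \<Rightarrow> (real^'n)^'p" where
  "noise k s = (\<chi> i. C (s (k, i)) (estimate k s $ i) - estimate k s $ i)"

lemma decision_0: "decision 0 s = x0" and estimate_0: "estimate 0 s = x0"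
  by (simp_all add: decision_def estimate_def state_def)

lemma decision_Suc:
  "decision (Suc k) s = (\<chi> i. closest_point (X i)
     (decision k s $ i - (\<alpha> k * \<beta> k) *\<^sub>R g_fun f i (decision k s $ i) (estimate k s $ i)))"
  by (simp add: decision_def estimate_def state_def Let_def case_prod_beta)

text \<open>A message is the estimate plus its compression error, so the mixing step is
  \<open>diffusion\<close> of their sum. Weights outside the neighbourhood vanish, which allows
  summing over all players.\<close>

lemma estimate_Suc:
  "estimate (Suc k) s = estimate k s + \<beta> k *\<^sub>R diffusion w (estimate k s + noise k s)
     + (decision (Suc k) s - decision k s)"
proof -
  have nbrs: "(\<Sum>j\<in>nbrs w i. w i j *\<^sub>R h j) = (\<Sum>j\<in>UNIV. w i j *\<^sub>R h j)" for i and h :: "'p \<Rightarrow> real^'n"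
    using graph(1) by (intro sum.mono_neutral_left)
      (auto simp: nbrs_def undirected_weights_def order.order_iff_strict)
  show ?thesis
    by (simp add: decision_def estimate_def noise_def state_def Let_def case_prod_beta vec_eq_iff
        diffusion_def nbrs)
qed

lemma state_cong:
  assumes "\<And>l i. l < k \<Longrightarrow> s (l, i) = s' (l, i)"
  shows "decision k s = decision k s' \<and> estimate k s = estimate k s'"
  using assms
proof (induction k)
  case (Suc k)
  then show ?case by (simp add: decision_Suc estimate_Suc noise_def)
qed (simp add: decision_0 estimate_0)

lemma decision_Suc_cong:
  assumes "\<And>l i. l < k \<Longrightarrow> s (l, i) = s' (l, i)"
  shows "decision (Suc k) s = decision (Suc k) s'"
  using state_cong[of k s s'] assms by (simp add: decision_Suc)

lemma equilibrium_mem: "xs $ i \<in> X i"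
  using xs by (simp add: nash_equilibrium_def profiles_def)

text \<open>The initial decision is arbitrary and may lie outside the decision sets; feasibility
  starts with the first projection.\<close>

lemma decision_mem: "k > 0 \<Longrightarrow> decision k s $ i \<in> X i"
  using X equilibrium_mem by (cases k) (auto simp: decision_Suc intro!: closest_point_in_set)

section \<open>Measurability of the iterates as functions of the seeds\<close>

lemma compressor_measurable: "(\<lambda>(r, x). C r x) \<in> borel_measurable (R \<Otimes>\<^sub>M borel)"
  and seeds_indep: "indep_vars (\<lambda>_. R) (\<lambda>(k, i). \<xi> k i) UNIV"
  and noise_moments: "integrable M (\<lambda>\<omega>. (norm (C (\<xi> k i \<omega>) x - x))\<^sup>2)"
    "(LINT \<omega>|M. C (\<xi> k i \<omega>) x) = x" "(LINT \<omega>|M. (norm (C (\<xi> k i \<omega>) x - x))\<^sup>2) \<le> \<sigma>\<^sup>2"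
  using compression by (auto simp: unbiased_compression_def)

text \<open>Continuity of \<open>g_fun\<close> is available only on the closed set
  \<open>X i \<times> UNIV\<close>. Multiplying by its indicator gives a Borel function on the whole
  space that agrees with \<open>g_fun\<close> along \<open>F\<close>.\<close>

lemma gradient_measurable:
  assumes [measurable]: "F \<in> borel_measurable N" "G \<in> borel_measurable N" and "\<And>s. F s \<in> X i"
  shows "(\<lambda>s. g_fun f i (F s) (G s)) \<in> borel_measurable N"
proof -
  have "closed (X i \<times> (UNIV :: (real^'n) set))" using X by (intro closed_Times) auto
  then have [measurable]: "(\<lambda>p. indicator (X i \<times> UNIV) p *\<^sub>R (case p of (u, z) \<Rightarrow> g_fun f i u z)) \<in> borel_measurable borel"
    by (intro borel_measurable_continuous_on_indicator g_fun_continuous_on f_C1) simp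
  have "(\<lambda>s. indicator (X i \<times> UNIV) (F s, G s) *\<^sub>R (case (F s, G s) of (u, z) \<Rightarrow> g_fun f i u z)) \<in> borel_measurable N"
    by measurable
  then show ?thesis using assms(3) by simp
qed

lemma decision_Suc_measurable:
  assumes [measurable]: "decision k \<in> borel_measurable N" "estimate k \<in> borel_measurable N"
  shows "decision (Suc k) \<in> borel_measurable N"
proof -
  have g: "(\<lambda>s. g_fun f i (decision k s $ i) (estimate k s $ i)) \<in> borel_measurable N" for i
  \<comment> \<open>At \<open>k = 0\<close> the decision may be infeasible, but the gradient does
    not depend on the seeds and is measurable as a constant.\<close>
  proof (cases "k = 0")
    case False
    then show ?thesis by (intro gradient_measurable) (auto simp: decision_mem)
  qed (simp add: decision_0 estimate_0)
  have "closest_point (X i) \<in> borel_measurable borel" for i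
    using X equilibrium_mem by (intro borel_measurable_continuous_onI continuous_on_closest_point) auto
  note [measurable] = g measurable_compose[OF _ this]
  have "(\<lambda>s. \<chi> i. closest_point (X i)
     (decision k s $ i - (\<alpha> k * \<beta> k) *\<^sub>R g_fun f i (decision k s $ i) (estimate k s $ i))) \<in> borel_measurable N"
    by (rule borel_measurable_vec_lambda) measurable
  then show ?thesis unfolding decision_Suc[abs_def] .
qed

lemma noise_measurable:
  assumes [measurable]: "estimate k \<in> borel_measurable (PiM J (\<lambda>_. R))" and "{k} \<times> UNIV \<subseteq> J"
  shows "noise k \<in> borel_measurable (PiM J (\<lambda>_. R))"
proof -
  have s: "(\<lambda>s. s (k, i)) \<in> measurable (PiM J (\<lambda>_. R)) R" for i
    using assms(2) by (intro measurable_component_singleton) auto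
  have "(\<lambda>s. C (s (k, i)) (estimate k s $ i)) \<in> borel_measurable (PiM J (\<lambda>_. R))" for i
  proof -
    have "(\<lambda>s. (s (k, i), estimate k s $ i)) \<in> measurable (PiM J (\<lambda>_. R)) (R \<Otimes>\<^sub>M borel)"
      using s by measurable
    from measurable_compose[OF this compressor_measurable] show ?thesis by simp
  qed
  note [measurable] = this
  show ?thesis unfolding noise_def[abs_def]
    by (rule borel_measurable_vec_lambda) measurable
qed

text \<open>The index set \<open>J\<close> is kept general because the result is used both for the
  seeds of the past and for the family of all seeds.\<close>

lemma state_measurable:
  assumes "{..<k} \<times> UNIV \<subseteq> J"
  shows "decision k \<in> borel_measurable (PiM J (\<lambda>_. R)) \<and> estimate k \<in> borel_measurable (PiM J (\<lambda>_. R))"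
  using assms
proof (induction k)
  case 0
  then show ?case by (simp add: decision_0[abs_def] estimate_0[abs_def])
next
  case (Suc k)
  then have [measurable]: "decision k \<in> borel_measurable (PiM J (\<lambda>_. R))"
      "estimate k \<in> borel_measurable (PiM J (\<lambda>_. R))" by fastforce+
  have [measurable]: "decision (Suc k) \<in> borel_measurable (PiM J (\<lambda>_. R))"
    by (rule decision_Suc_measurable) fact+
  have [measurable]: "noise k \<in> borel_measurable (PiM J (\<lambda>_. R))"
    using Suc.prems by (intro noise_measurable) auto
  have [measurable]: "(\<lambda>s. diffusion w (estimate k s + noise k s)) \<in> borel_measurable (PiM J (\<lambda>_. R))"
    by (rule borel_measurable_linear[OF diffusion_linear]) measurable
  show ?case unfolding estimate_Suc[abs_def] by measurable
qed

section \<open>Independence of the past from a current seed\<close>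

lemma past_measurable: "past k \<in> measurable M (PiM ({..<k} \<times> UNIV) (\<lambda>_. R))"
  unfolding past_def seeds_def
proof (rule measurable_restrict)
  fix p :: "nat \<times> 'p"
  show "(\<lambda>\<omega>. (case p of (l, i) \<Rightarrow> \<xi> l i \<omega>)) \<in> measurable M R"
    using seeds_indep unfolding indep_vars_def by (cases p) auto
qed

text \<open>\<open>indep_var\<close> is restricted to random variables of equal type; hence the current seed
  enters as a family over a singleton index set.\<close>

lemma past_indep:
  "indep_var (PiM ({..<k} \<times> UNIV) (\<lambda>_. R)) (past k)
     (PiM {(k, i)} (\<lambda>_. R)) (\<lambda>\<omega>. restrict (seeds \<omega>) {(k, i)})"
  using indep_var_restrict[OF seeds_indep, of "{..<k} \<times> UNIV" "{(k, i)}"]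
  by (simp add: past_def[abs_def] seeds_def case_prod_beta')

lemma past_state:
  shows "decision k (past k \<omega>) = decision k (seeds \<omega>)"
    and "estimate k (past k \<omega>) = estimate k (seeds \<omega>)"
    and "decision (Suc k) (past k \<omega>) = decision (Suc k) (seeds \<omega>)"
  using state_cong[of k "past k \<omega>" "seeds \<omega>"] decision_Suc_cong[of k "past k \<omega>" "seeds \<omega>"]
  by (auto simp: past_def)

section \<open>Recursion for the disagreement of the estimates\<close>

definition deviation :: "nat \<Rightarrow> (nat \<times> 'p \<Rightarrow> 'r) \<Rightarrow> (real^'n)^'p" where
  "deviation k s = disagreement (estimate k s)"

text \<open>The part of \<open>deviation (Suc k)\<close> fixed by the seeds before iteration
  \<open>k\<close>. The next decision may enter, since it reads no message of iteration
  \<open>k\<close>.\<close>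

definition drift :: "nat \<Rightarrow> (nat \<times> 'p \<Rightarrow> 'r) \<Rightarrow> (real^'n)^'p" where
  "drift k s = deviation k s + \<beta> k *\<^sub>R diffusion w (deviation k s)
     + disagreement (decision (Suc k) s - decision k s)"

text \<open>The tracking invariant: both profiles start at \<open>x0\<close>, diffusion preserves
  the average, and each estimate receives the increment of its player's decision.\<close>

lemma aggregate_estimate: "aggregate (estimate k s) = aggregate (decision k s)"
proof (induction k)
  case (Suc k)
  then show ?case
    by (simp add: estimate_Suc linear_add[OF aggregate_linear] linear_diff[OF aggregate_linear]
        linear_scale[OF aggregate_linear] aggregate_diffusion[OF graph(1)])
qed (simp add: decision_0 estimate_0)

lemma deviation_Suc: "deviation (Suc k) s = drift k s + \<beta> k *\<^sub>R diffusion w (noise k s)"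
  by (simp add: deviation_def drift_def estimate_Suc linear_add[OF disagreement_linear]
      linear_scale[OF disagreement_linear] disagreement_diffusion[OF graph(1)]
      linear_add[OF diffusion_linear] diffusion_disagreement scaleR_add_right)

section \<open>Pathwise bounds and one-step inequalities\<close>

lemma decision_bounded:
  obtains b where "b \<ge> 0" "\<And>k s. norm (decision k s - xs) \<le> b"
proof -
  have "\<forall>i. \<exists>c. \<forall>u\<in>X i. norm u \<le> c" using X by (simp add: bounded_iff)
  then obtain c where c: "\<And>i u. u \<in> X i \<Longrightarrow> norm u \<le> c i" by metis
  \<comment> \<open>The first entry of the maximum covers \<open>k = 0\<close>, where the decision
    need not be feasible; the second bounds the distance of any two feasible profiles.\<close>
  have "norm (decision k s - xs) \<le> max (norm (x0 - xs)) (\<Sum>i\<in>UNIV. c i + c i)" for k s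
  proof (cases "k = 0")
    case False
    have "norm (decision k s - xs) \<le> (\<Sum>i\<in>UNIV. norm ((decision k s - xs) $ i))"
      by (rule norm_vec_le_sum)
    also have "\<dots> \<le> (\<Sum>i\<in>UNIV. c i + c i)"
    proof (rule sum_mono)
      fix i
      show "norm ((decision k s - xs) $ i) \<le> c i + c i"
        using norm_triangle_ineq4[of "decision k s $ i" "xs $ i"]
          c[OF decision_mem[of k s i]] c[OF equilibrium_mem[of i]] False by simp
    qed
    finally show ?thesis by simp
  qed (simp add: decision_0)
  then show ?thesis
    by (rule that[rotated]) (simp add: max.coboundedI1)
qed

text \<open>For \<open>k > 0\<close> the current decision is its own projection, so nonexpansiveness
  bounds the move of each player by the length of the gradient step.\<close>

lemma decision_increment:
  assumes "k > 0"
  shows "norm (decision (Suc k) s - decision k s) \<le> real CARD('p) * B * (\<alpha> k * \<beta> k)"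
proof -
  have "norm (decision (Suc k) s - decision k s) \<le> (\<Sum>i\<in>UNIV. norm ((decision (Suc k) s - decision k s) $ i))"
    by (rule norm_vec_le_sum)
  also have "\<dots> \<le> (\<Sum>i\<in>(UNIV :: 'p set). \<alpha> k * \<beta> k * B)"
  proof (rule sum_mono)
    fix i
    let ?x = "decision k s $ i" and ?g = "g_fun f i (decision k s $ i) (estimate k s $ i)"
    have x: "?x \<in> X i" by (rule decision_mem[OF assms])
    have "norm ((decision (Suc k) s - decision k s) $ i)
        = dist (closest_point (X i) (?x - (\<alpha> k * \<beta> k) *\<^sub>R ?g)) (closest_point (X i) ?x)"
      using closest_point_self[OF x] by (simp add: decision_Suc dist_norm)
    also have "\<dots> \<le> dist (?x - (\<alpha> k * \<beta> k) *\<^sub>R ?g) ?x"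
      using X x by (intro closest_point_lipschitz) auto
    also have "\<dots> = \<alpha> k * \<beta> k * norm ?g"
      using step_pos by (simp add: dist_norm abs_mult less_imp_le)
    also have "\<dots> \<le> \<alpha> k * \<beta> k * B"
      using step_pos g_bound[OF x] by (intro mult_left_mono) (auto simp: less_imp_le)
    finally show "norm ((decision (Suc k) s - decision k s) $ i) \<le> \<alpha> k * \<beta> k * B" .
  qed
  finally show ?thesis by (simp add: mult_ac)
qed

text \<open>Square summability sends \<open>\<beta>\<close> to 0. The three conclusions serve the
  one-step inequalities: feasible decisions, \<open>\<beta> k\<close> dominating its own square, and
  a step small against a given constant.\<close>

lemma eventually_small_step:
  assumes "c > 0"
  shows "\<forall>\<^sub>F k in sequentially. k > 0 \<and> \<beta> k \<le> 1 \<and> \<beta> k \<le> c"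
proof -
  have "(\<lambda>k. sqrt ((\<beta> k)\<^sup>2)) \<longlonglongrightarrow> sqrt 0"
    by (intro tendsto_real_sqrt summable_LIMSEQ_zero step_sum)
  then have "\<beta> \<longlonglongrightarrow> 0" using step_pos by (simp add: less_imp_le)
  then have "\<forall>\<^sub>F k in sequentially. \<beta> k < min 1 c"
    by (rule order_tendstoD(2)) (use assms in simp)
  then show ?thesis using eventually_gt_at_top[of 0] by eventually_elim auto
qed

text \<open>In the expanded square the spectral gap gains 2 \<nu> \<beta> |\<delta>|^2. The cross
  term with the decision increment gives back \<nu> \<beta> |\<delta>|^2 and the squared diffusion
  step half of that, which leaves the rate \<mu> = \<nu> / 2.\<close>

lemma drift_contraction:
  obtains c \<mu> where "c \<ge> 0" "\<mu> > 0"
    "\<forall>\<^sub>F k in sequentially. \<forall>s.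
       (norm (drift k s))\<^sup>2 + \<beta> k * \<mu> * (norm (deviation k s))\<^sup>2
         \<le> (norm (deviation k s))\<^sup>2 + c * ((\<alpha> k)\<^sup>2 * \<beta> k)"
proof -
  obtain \<nu> where \<nu>: "\<nu> > 0"
    "\<And>y :: (real^'n)^'p. (\<Sum>i\<in>UNIV. y $ i) = 0 \<Longrightarrow> y \<bullet> diffusion w y \<le> - \<nu> * (norm y)\<^sup>2"
    using spectral_gap[OF graph] by blast
  obtain K where K: "K > 0" "\<And>v :: (real^'n)^'p. norm (diffusion w v) \<le> K * norm v"
    using linear_bounded_pos[OF diffusion_linear] by blast
  obtain P where P: "P > 0" "\<And>v :: (real^'n)^'p. norm (disagreement v) \<le> P * norm v"
    using linear_bounded_pos[OF disagreement_linear] by blast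
  \<comment> \<open>Chosen so that the disagreement of the decision increment has norm at most
    \<open>G * \<alpha> k * \<beta> k\<close>.\<close>
  define G where "G = P * (real CARD('p) * B)"
  define c where "c = G\<^sup>2 / \<nu> + 2 * G\<^sup>2"
  have "c \<ge> 0" using \<nu>(1) by (simp add: c_def)
  have bound: "(norm (drift k s))\<^sup>2 + \<beta> k * (\<nu> / 2) * (norm (deviation k s))\<^sup>2
         \<le> (norm (deviation k s))\<^sup>2 + c * ((\<alpha> k)\<^sup>2 * \<beta> k)"
    \<comment> \<open>The threshold \<open>\<nu> / (4 * K\<^sup>2)\<close> makes the squared
      diffusion step at most a quarter of \<open>\<nu> * \<beta> k\<close> times the squared
      deviation; splitting the square of the sum doubles it.\<close>
    if k: "k > 0" "\<beta> k \<le> 1" "\<beta> k \<le> \<nu> / (4 * K\<^sup>2)" for k s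
  proof -
    define \<delta> where "\<delta> = deviation k s"
    define d where "d = disagreement (decision (Suc k) s - decision k s)"
    let ?b = "\<beta> k" and ?a = "\<alpha> k" and ?L = "diffusion w \<delta>"
    have b: "?b > 0" and a: "?a > 0" using step_pos by auto
    have "norm d \<le> P * norm (decision (Suc k) s - decision k s)" unfolding d_def by (rule P(2))
    also have "\<dots> \<le> P * (real CARD('p) * B * (?a * ?b))"
      using P(1) decision_increment[OF k(1)] by (intro mult_left_mono) auto
    finally have d: "norm d \<le> G * ?a * ?b" by (simp add: G_def mult_ac)
    have gap: "\<delta> \<bullet> ?L \<le> - \<nu> * (norm \<delta>)\<^sup>2"
      unfolding \<delta>_def deviation_def by (rule \<nu>(2)[OF sum_disagreement])
    have "(norm (drift k s))\<^sup>2 = (norm (\<delta> + (?b *\<^sub>R ?L + d)))\<^sup>2"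
      by (simp add: drift_def \<delta>_def d_def add.assoc)
    also have "\<dots> = (norm \<delta>)\<^sup>2 + 2 * (\<delta> \<bullet> (?b *\<^sub>R ?L + d)) + (norm (?b *\<^sub>R ?L + d))\<^sup>2"
      by (simp add: power2_norm_eq_inner inner_add_left inner_add_right inner_commute)
    also have "\<delta> \<bullet> (?b *\<^sub>R ?L + d) = ?b * (\<delta> \<bullet> ?L) + \<delta> \<bullet> d"
      by (simp add: inner_add_right)
    finally have drift: "(norm (drift k s))\<^sup>2
      = (norm \<delta>)\<^sup>2 + 2 * (?b * (\<delta> \<bullet> ?L) + \<delta> \<bullet> d) + (norm (?b *\<^sub>R ?L + d))\<^sup>2" .
    have 1: "?b * (\<delta> \<bullet> ?L) \<le> - ?b * \<nu> * (norm \<delta>)\<^sup>2"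
      using mult_left_mono[OF gap, of ?b] b by (simp add: mult_ac)
    have "2 * (\<delta> \<bullet> d) \<le> 2 * (norm \<delta> * norm d)" using norm_cauchy_schwarz[of \<delta> d] by simp
    also have "\<dots> \<le> 2 * (norm \<delta> * (G * ?a * ?b))"
      using d by (intro mult_left_mono) auto
    also have "\<dots> \<le> ?b * (\<nu> * (norm \<delta>)\<^sup>2 + G\<^sup>2 / \<nu> * ?a\<^sup>2)"
    proof -
      \<comment> \<open>Young's inequality with weight \<open>\<nu>\<close>, obtained by completing
        the square, so that the cross term uses up only half of the gain.\<close>
      have "0 \<le> ?b * (\<nu> * (norm \<delta> - G * ?a / \<nu>)\<^sup>2)" using b \<nu>(1) by simp
      also have "\<nu> * (norm \<delta> - G * ?a / \<nu>)\<^sup>2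
          = \<nu> * (norm \<delta>)\<^sup>2 + G\<^sup>2 / \<nu> * ?a\<^sup>2 - 2 * (norm \<delta> * (G * ?a))"
        using \<nu>(1) by (simp add: power2_eq_square field_simps)
      finally show ?thesis by (simp add: algebra_simps)
    qed
    finally have 2: "2 * (\<delta> \<bullet> d) \<le> ?b * (\<nu> * (norm \<delta>)\<^sup>2) + G\<^sup>2 / \<nu> * (?a\<^sup>2 * ?b)"
      by (simp add: algebra_simps)
    have "(norm (?b *\<^sub>R ?L + d))\<^sup>2 \<le> 2 * (norm (?b *\<^sub>R ?L))\<^sup>2 + 2 * (norm d)\<^sup>2"
      by (rule power2_norm_add_le)
    moreover have "(norm (?b *\<^sub>R ?L))\<^sup>2 \<le> ?b * (\<nu> / 4) * (norm \<delta>)\<^sup>2"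
    proof -
      have "(norm (?b *\<^sub>R ?L))\<^sup>2 = ?b\<^sup>2 * (norm ?L)\<^sup>2" by (simp add: power_mult_distrib)
      also have "\<dots> \<le> ?b\<^sup>2 * (K * norm \<delta>)\<^sup>2" by (intro mult_left_mono power_mono K(2)) auto
      also have "\<dots> = ?b * (?b * K\<^sup>2) * (norm \<delta>)\<^sup>2" by (simp add: power2_eq_square mult_ac)
      also have "\<dots> \<le> ?b * (\<nu> / 4) * (norm \<delta>)\<^sup>2"
        using b k(3) K(1) by (intro mult_right_mono mult_left_mono) (auto simp: field_simps)
      finally show ?thesis .
    qed
    moreover have "(norm d)\<^sup>2 \<le> G\<^sup>2 * (?a\<^sup>2 * ?b)"
    proof -
      have "(norm d)\<^sup>2 \<le> (G * ?a * ?b)\<^sup>2" using d by (intro power_mono) auto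
      also have "\<dots> = G\<^sup>2 * ?a\<^sup>2 * ?b * ?b" by (simp add: power2_eq_square mult_ac)
      also have "\<dots> \<le> G\<^sup>2 * ?a\<^sup>2 * ?b * 1" using b k(2) by (intro mult_left_mono) auto
      finally show ?thesis by (simp add: mult_ac)
    qed
    ultimately have 3: "(norm (?b *\<^sub>R ?L + d))\<^sup>2 \<le> ?b * (\<nu> / 2) * (norm \<delta>)\<^sup>2 + 2 * G\<^sup>2 * (?a\<^sup>2 * ?b)"
      by simp
    have "c * (?a\<^sup>2 * ?b) = G\<^sup>2 / \<nu> * (?a\<^sup>2 * ?b) + 2 * G\<^sup>2 * (?a\<^sup>2 * ?b)"
      unfolding c_def by (rule distrib_right)
    then show ?thesis
      using drift 1 2 3 unfolding \<delta>_def[symmetric] by (simp add: algebra_simps)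
  qed
  have "\<forall>\<^sub>F k in sequentially. \<forall>s.
       (norm (drift k s))\<^sup>2 + \<beta> k * (\<nu> / 2) * (norm (deviation k s))\<^sup>2
         \<le> (norm (deviation k s))\<^sup>2 + c * ((\<alpha> k)\<^sup>2 * \<beta> k)"
    by (rule eventually_mono[OF eventually_small_step[of "\<nu> / (4 * K\<^sup>2)"]]) (use bound \<nu>(1) K(1) in auto)
  then show ?thesis using that[of c "\<nu> / 2"] \<open>c \<ge> 0\<close> \<nu>(1) by simp
qed

text \<open>Both \<open>decision (Suc k) s\<close> and \<open>xs\<close> are projections, so their
  distance is at most that before projecting. Replacing \<open>g_fun\<close> at the estimates by
  \<open>phi\<close> costs a multiple of the deviation, because the estimates average to the true
  aggregate; strong monotonicity handles \<open>phi\<close>.\<close>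

lemma equilibrium_contraction:
  obtains c where "c \<ge> 0"
    "\<forall>\<^sub>F k in sequentially. \<forall>s.
       (norm (decision (Suc k) s - xs))\<^sup>2 + 2 * m * (\<alpha> k * \<beta> k) * (norm (decision k s - xs))\<^sup>2
         \<le> (norm (decision k s - xs))\<^sup>2 + c * ((\<alpha> k)\<^sup>2 * \<beta> k + \<beta> k * (norm (deviation k s))\<^sup>2)"
proof -
  obtain b where b: "b \<ge> 0" "\<And>k s. norm (decision k s - xs) \<le> b" using decision_bounded by blast
  define N where "N = real CARD('p)"
  \<comment> \<open>The first summand pays for the gradient error, the second for the squared
    gradient step.\<close>
  define c where "c = N * (b * \<bar>L\<^sub>g\<bar> + B\<^sup>2)"
  have "c \<ge> 0" using b by (simp add: c_def N_def)
  have "(norm (decision (Suc k) s - xs))\<^sup>2 + 2 * m * (\<alpha> k * \<beta> k) * (norm (decision k s - xs))\<^sup>2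
         \<le> (norm (decision k s - xs))\<^sup>2 + c * ((\<alpha> k)\<^sup>2 * \<beta> k + \<beta> k * (norm (deviation k s))\<^sup>2)"
    if k: "k > 0" "\<beta> k \<le> 1" for k s
  proof -
    define x where "x = decision k s"
    define a where "a = \<alpha> k * \<beta> k"
    define g where "g i = g_fun f i (x $ i) (estimate k s $ i)" for i
    define \<delta> where "\<delta> = deviation k s"
    have a: "a > 0" using step_pos by (simp add: a_def)
    have mem: "x $ i \<in> X i" for i unfolding x_def by (rule decision_mem[OF k(1)])
    have diff: "(\<lambda>(u, v). f i u v) differentiable (at (u, v))" if "u \<in> X i" for i u v
      using f_C1[of i] that unfolding cont_differentiable_on_def by blast
    have g_inner: "(x $ i - xs $ i) \<bullet> g i \<ge> (x $ i - xs $ i) \<bullet> phi f i x - b * \<bar>L\<^sub>g\<bar> * norm \<delta>" for i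
    proof -
      have comp: "norm (x $ i - xs $ i) \<le> b"
        using Finite_Cartesian_Product.norm_nth_le[of "x - xs" i] b(2)[of k s] by (simp add: x_def)
      have "norm (phi f i x - g i) = norm (g_fun f i (x $ i) (aggregate x) - g_fun f i (x $ i) (estimate k s $ i))"
        using phi_eq_g_fun[of f i x, OF diff[OF mem]] by (simp add: g_def)
      also have "\<dots> \<le> L\<^sub>g * norm (aggregate x - estimate k s $ i)"
        by (rule g_Lipschitz[OF mem])
      \<comment> \<open>The absolute value keeps the factor nonnegative, since no sign of
        \<open>L\<^sub>g\<close> is assumed.\<close>
      also have "\<dots> \<le> \<bar>L\<^sub>g\<bar> * norm (aggregate x - estimate k s $ i)"
        by (intro mult_right_mono) auto
      also have "norm (aggregate x - estimate k s $ i) = norm (\<delta> $ i)"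
        by (simp add: \<delta>_def deviation_def disagreement_def aggregate_estimate x_def norm_minus_commute)
      also have "\<bar>L\<^sub>g\<bar> * norm (\<delta> $ i) \<le> \<bar>L\<^sub>g\<bar> * norm \<delta>"
        by (intro mult_left_mono Finite_Cartesian_Product.norm_nth_le) auto
      finally have "norm (x $ i - xs $ i) * norm (phi f i x - g i) \<le> b * (\<bar>L\<^sub>g\<bar> * norm \<delta>)"
        using comp b(1) by (intro mult_mono) auto
      then show ?thesis
        using norm_cauchy_schwarz[of "x $ i - xs $ i" "phi f i x - g i"] by (simp add: inner_diff_right)
    qed
    have "m * (norm (x - xs))\<^sup>2 \<le> (x - xs) \<bullet> Phi f x"
    proof -
      \<comment> \<open>The variational inequality, summed over the players, allows dropping
        \<open>Phi f xs\<close> from strong monotonicity.\<close>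
      have "(x $ i - xs $ i) \<bullet> phi f i xs \<ge> 0" for i
        using X by (intro nash_variational[where X = X] xs mem diff equilibrium_mem) auto
      then have "(\<Sum>i\<in>UNIV. (x $ i - xs $ i) \<bullet> phi f i xs) \<ge> 0"
        by (rule sum_nonneg)
      then have "(x - xs) \<bullet> Phi f xs \<ge> 0"
        unfolding inner_vec_def[of "x - xs"] Phi_def by simp
      then show ?thesis using strong_mono[of x] by (simp add: inner_diff_right)
    qed
    also have "\<dots> = (\<Sum>i\<in>UNIV. (x $ i - xs $ i) \<bullet> phi f i x)"
      by (simp add: inner_vec_def Phi_def)
    also have "\<dots> \<le> (\<Sum>i\<in>UNIV. (x $ i - xs $ i) \<bullet> g i + b * \<bar>L\<^sub>g\<bar> * norm \<delta>)"
      using g_inner by (intro sum_mono) (simp add: algebra_simps)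
    also have "\<dots> = (\<Sum>i\<in>UNIV. (x $ i - xs $ i) \<bullet> g i) + N * (b * \<bar>L\<^sub>g\<bar> * norm \<delta>)"
      by (simp add: sum.distrib N_def)
    finally have mono: "m * (norm (x - xs))\<^sup>2 \<le> (\<Sum>i\<in>UNIV. (x $ i - xs $ i) \<bullet> g i) + N * (b * \<bar>L\<^sub>g\<bar> * norm \<delta>)" .
    have "(norm (decision (Suc k) s - xs))\<^sup>2 = (\<Sum>i\<in>UNIV. (norm (decision (Suc k) s $ i - xs $ i))\<^sup>2)"
      by (simp add: power2_norm_vec[where 'b = "real^'n"])
    also have "\<dots> \<le> (\<Sum>i\<in>UNIV. (norm (x $ i - xs $ i))\<^sup>2 - 2 * a * ((x $ i - xs $ i) \<bullet> g i) + a\<^sup>2 * B\<^sup>2)"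
    proof (rule sum_mono)
      fix i
      have "norm (decision (Suc k) s $ i - xs $ i)
          = dist (closest_point (X i) (x $ i - a *\<^sub>R g i)) (closest_point (X i) (xs $ i))"
        using closest_point_self[OF equilibrium_mem]
        by (simp add: decision_Suc dist_norm x_def a_def g_def)
      also have "\<dots> \<le> dist (x $ i - a *\<^sub>R g i) (xs $ i)"
        using X mem[of i] by (intro closest_point_lipschitz) auto
      also have "\<dots> = norm ((x $ i - xs $ i) - a *\<^sub>R g i)"
        by (simp add: dist_norm algebra_simps)
      finally have "(norm (decision (Suc k) s $ i - xs $ i))\<^sup>2 \<le> (norm ((x $ i - xs $ i) - a *\<^sub>R g i))\<^sup>2"
        by (intro power_mono) auto
      also have "\<dots> = (norm (x $ i - xs $ i))\<^sup>2 - 2 * a * ((x $ i - xs $ i) \<bullet> g i) + a\<^sup>2 * (norm (g i))\<^sup>2"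
        unfolding power2_norm_eq_inner
        by (simp add: inner_diff_left inner_diff_right inner_commute power2_eq_square algebra_simps)
      also have "\<dots> \<le> (norm (x $ i - xs $ i))\<^sup>2 - 2 * a * ((x $ i - xs $ i) \<bullet> g i) + a\<^sup>2 * B\<^sup>2"
        using g_bound[OF mem, of i] by (intro add_left_mono mult_left_mono power_mono) (auto simp: g_def)
      finally show "(norm (decision (Suc k) s $ i - xs $ i))\<^sup>2 \<le> \<dots>" .
    qed
    also have "\<dots> = (norm (x - xs))\<^sup>2 - 2 * a * (\<Sum>i\<in>UNIV. (x $ i - xs $ i) \<bullet> g i) + N * (a\<^sup>2 * B\<^sup>2)"
      by (simp add: power2_norm_vec[where 'b = "real^'n"] sum.distrib sum_subtractf sum_distrib_left N_def)
    finally have "(norm (decision (Suc k) s - xs))\<^sup>2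
      \<le> (norm (x - xs))\<^sup>2 - 2 * a * (\<Sum>i\<in>UNIV. (x $ i - xs $ i) \<bullet> g i) + N * (a\<^sup>2 * B\<^sup>2)" .
    moreover have "2 * a * (m * (norm (x - xs))\<^sup>2)
        \<le> 2 * a * ((\<Sum>i\<in>UNIV. (x $ i - xs $ i) \<bullet> g i) + N * (b * \<bar>L\<^sub>g\<bar> * norm \<delta>))"
      using mono a by (intro mult_left_mono) auto
    ultimately have main: "(norm (decision (Suc k) s - xs))\<^sup>2 + 2 * m * a * (norm (x - xs))\<^sup>2
        \<le> (norm (x - xs))\<^sup>2 + N * b * \<bar>L\<^sub>g\<bar> * (2 * a * norm \<delta>) + N * B\<^sup>2 * a\<^sup>2"
      by (simp add: algebra_simps)
    \<comment> \<open>Weighting by \<open>\<beta> k\<close> splits the cross term into two pieces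
      that are summable in expectation, with no bound on \<open>\<alpha>\<close>.\<close>
    have "0 \<le> \<beta> k * (\<alpha> k - norm \<delta>)\<^sup>2" using step_pos[of k] by simp
    then have young: "2 * a * norm \<delta> \<le> (\<alpha> k)\<^sup>2 * \<beta> k + \<beta> k * (norm \<delta>)\<^sup>2"
      by (simp add: a_def power2_eq_square algebra_simps)
    have "(\<alpha> k)\<^sup>2 * \<beta> k * \<beta> k \<le> (\<alpha> k)\<^sup>2 * \<beta> k * 1"
      using k(2) step_pos(2)[of k] by (intro mult_left_mono) auto
    moreover have "0 \<le> \<beta> k * (norm \<delta>)\<^sup>2" using step_pos(2)[of k] by simp
    ultimately have "a\<^sup>2 \<le> (\<alpha> k)\<^sup>2 * \<beta> k + \<beta> k * (norm \<delta>)\<^sup>2"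
      by (simp add: a_def power2_eq_square algebra_simps)
    from mult_left_mono[OF this, of "N * B\<^sup>2"] mult_left_mono[OF young, of "N * b * \<bar>L\<^sub>g\<bar>"] b(1)
    have "N * b * \<bar>L\<^sub>g\<bar> * (2 * a * norm \<delta>) + N * B\<^sup>2 * a\<^sup>2
        \<le> c * ((\<alpha> k)\<^sup>2 * \<beta> k + \<beta> k * (norm \<delta>)\<^sup>2)"
      by (simp add: N_def c_def algebra_simps)
    with main show ?thesis unfolding x_def a_def \<delta>_def by linarith
  qed
  then have "\<forall>\<^sub>F k in sequentially. \<forall>s.
       (norm (decision (Suc k) s - xs))\<^sup>2 + 2 * m * (\<alpha> k * \<beta> k) * (norm (decision k s - xs))\<^sup>2
         \<le> (norm (decision k s - xs))\<^sup>2 + c * ((\<alpha> k)\<^sup>2 * \<beta> k + \<beta> k * (norm (deviation k s))\<^sup>2)"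
    by (intro eventually_mono[OF eventually_small_step[of 1]]) auto
  then show ?thesis using that \<open>c \<ge> 0\<close> by blast
qed

section \<open>Moments of the compression errors along the trajectory\<close>

lemma seeds_measurable: "seeds \<in> measurable M (PiM UNIV (\<lambda>_. R))"
proof -
  have "(\<lambda>\<omega>. \<lambda>p\<in>UNIV. seeds \<omega> p) \<in> measurable M (PiM UNIV (\<lambda>_. R))"
  proof (rule measurable_restrict)
    fix p :: "nat \<times> 'p"
    show "(\<lambda>\<omega>. seeds \<omega> p) \<in> measurable M R"
      using seeds_indep unfolding indep_vars_def seeds_def by (cases p) auto
  qed
  then show ?thesis by (simp add: restrict_def)
qed

lemma trajectory_measurable [measurable]:
  "(\<lambda>\<omega>. decision k (seeds \<omega>)) \<in> borel_measurable M"
  "(\<lambda>\<omega>. estimate k (seeds \<omega>)) \<in> borel_measurable M"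
  "(\<lambda>\<omega>. noise k (seeds \<omega>)) \<in> borel_measurable M"
  "(\<lambda>\<omega>. deviation k (seeds \<omega>)) \<in> borel_measurable M"
  "(\<lambda>\<omega>. drift k (seeds \<omega>)) \<in> borel_measurable M"
proof -
  show [measurable]: "(\<lambda>\<omega>. decision k (seeds \<omega>)) \<in> borel_measurable M" for k
    using state_measurable[of k UNIV] measurable_compose[OF seeds_measurable] by blast
  show [measurable]: "(\<lambda>\<omega>. estimate k (seeds \<omega>)) \<in> borel_measurable M"
    using state_measurable[of k UNIV] measurable_compose[OF seeds_measurable] by blast
  show "(\<lambda>\<omega>. noise k (seeds \<omega>)) \<in> borel_measurable M"
    using noise_measurable[of k UNIV] state_measurable[of k UNIV] measurable_compose[OF seeds_measurable] by blast
  show dev[measurable]: "(\<lambda>\<omega>. deviation k (seeds \<omega>)) \<in> borel_measurable M"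
    unfolding deviation_def by (rule borel_measurable_linear[OF disagreement_linear]) measurable
  have [measurable]: "(\<lambda>\<omega>. diffusion w (deviation k (seeds \<omega>))) \<in> borel_measurable M"
    by (rule borel_measurable_linear[OF diffusion_linear dev])
  have [measurable]: "(\<lambda>\<omega>. disagreement (decision (Suc k) (seeds \<omega>) - decision k (seeds \<omega>))) \<in> borel_measurable M"
    by (rule borel_measurable_linear[OF disagreement_linear]) measurable
  show "(\<lambda>\<omega>. drift k (seeds \<omega>)) \<in> borel_measurable M"
    unfolding drift_def by measurable
qed

lemma drift_past_measurable: "drift k \<in> borel_measurable (PiM ({..<k} \<times> UNIV) (\<lambda>_. R))"
proof -
  let ?N = "PiM ({..<k} \<times> (UNIV :: 'p set)) (\<lambda>_. R)"
  have [measurable]: "decision k \<in> borel_measurable ?N" "estimate k \<in> borel_measurable ?N"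
    using state_measurable[of k "{..<k} \<times> UNIV"] by auto
  have [measurable]: "decision (Suc k) \<in> borel_measurable ?N"
    by (rule decision_Suc_measurable) measurable
  have dev[measurable]: "(\<lambda>s. deviation k s) \<in> borel_measurable ?N"
    unfolding deviation_def by (rule borel_measurable_linear[OF disagreement_linear]) measurable
  have [measurable]: "(\<lambda>s. diffusion w (deviation k s)) \<in> borel_measurable ?N"
    by (rule borel_measurable_linear[OF diffusion_linear dev])
  have [measurable]: "(\<lambda>s. disagreement (decision (Suc k) s - decision k s)) \<in> borel_measurable ?N"
    by (rule borel_measurable_linear[OF disagreement_linear]) measurable
  show ?thesis unfolding drift_def[abs_def] by measurable
qed

lemma drift_past: "drift k (past k \<omega>) = drift k (seeds \<omega>)"
  by (simp add: drift_def deviation_def past_state)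

text \<open>Instance of \<open>compression_error\<close> for one player: the conditioning variable
  is \<open>past k\<close>, the compressed input is a coordinate of \<open>estimate k\<close> read
  from that past, and the seed is unwrapped from its singleton family.\<close>

lemma noise_component:
  shows "integrable M (\<lambda>\<omega>. (norm (noise k (seeds \<omega>) $ i))\<^sup>2)"
    and "(LINT \<omega>|M. (norm (noise k (seeds \<omega>) $ i))\<^sup>2) \<le> \<sigma>\<^sup>2"
    and "Z \<in> borel_measurable (PiM ({..<k} \<times> UNIV) (\<lambda>_. R)) \<Longrightarrow>
      integrable M (\<lambda>\<omega>. (norm (Z (past k \<omega>)))\<^sup>2) \<Longrightarrow>
      integrable M (\<lambda>\<omega>. Z (past k \<omega>) \<bullet> noise k (seeds \<omega>) $ i) \<and>
      (LINT \<omega>|M. Z (past k \<omega>) \<bullet> noise k (seeds \<omega>) $ i) = 0"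
proof -
  let ?B = "PiM {(k, i)} (\<lambda>_. R)"
  have [measurable]: "(\<lambda>s. s (k, i)) \<in> measurable ?B R"
    by (rule measurable_component_singleton) simp
  have "(\<lambda>p. (fst p (k, i), snd p)) \<in> measurable (?B \<Otimes>\<^sub>M borel) (R \<Otimes>\<^sub>M borel)" by measurable
  from measurable_compose[OF this compressor_measurable]
  have meas: "(\<lambda>(r, x). C (r (k, i)) x) \<in> borel_measurable (?B \<Otimes>\<^sub>M borel)"
    by (simp add: case_prod_beta')
  have est: "(\<lambda>s. estimate k s $ i) \<in> borel_measurable (PiM ({..<k} \<times> UNIV) (\<lambda>_. R))"
    using state_measurable[of k "{..<k} \<times> UNIV"] by auto
  have noise: "noise k (seeds \<omega>) $ i = C (restrict (seeds \<omega>) {(k, i)} (k, i)) (estimate k (past k \<omega>) $ i)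
      - estimate k (past k \<omega>) $ i" for \<omega>
    by (simp add: noise_def past_state)
  have moments: "integrable M (\<lambda>\<omega>. (norm (C (restrict (seeds \<omega>) {(k, i)} (k, i)) x - x))\<^sup>2)"
    "(LINT \<omega>|M. C (restrict (seeds \<omega>) {(k, i)} (k, i)) x) = x"
    "(LINT \<omega>|M. (norm (C (restrict (seeds \<omega>) {(k, i)} (k, i)) x - x))\<^sup>2) \<le> \<sigma>\<^sup>2" for x
    using noise_moments[of k i x] by (simp_all add: seeds_def)
  show "integrable M (\<lambda>\<omega>. (norm (noise k (seeds \<omega>) $ i))\<^sup>2)"
    unfolding noise by (rule compression_error_integrable[OF past_indep[of k i] meas moments est])
  show "(LINT \<omega>|M. (norm (noise k (seeds \<omega>) $ i))\<^sup>2) \<le> \<sigma>\<^sup>2"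
    unfolding noise by (rule compression_error_variance[OF past_indep[of k i] meas moments est])
  show "integrable M (\<lambda>\<omega>. Z (past k \<omega>) \<bullet> noise k (seeds \<omega>) $ i) \<and>
      (LINT \<omega>|M. Z (past k \<omega>) \<bullet> noise k (seeds \<omega>) $ i) = 0"
    if "Z \<in> borel_measurable (PiM ({..<k} \<times> UNIV) (\<lambda>_. R))"
      "integrable M (\<lambda>\<omega>. (norm (Z (past k \<omega>)))\<^sup>2)"
    unfolding noise using that by (rule compression_error_orthogonal[OF past_indep[of k i] meas moments est])
qed

lemma noise_square_integrable: "integrable M (\<lambda>\<omega>. (norm (noise k (seeds \<omega>)))\<^sup>2)"
  unfolding power2_norm_vec[where 'b = "real^'n"] by (intro Bochner_Integration.integrable_sum noise_component)

lemma noise_variance: "(LINT \<omega>|M. (norm (noise k (seeds \<omega>)))\<^sup>2) \<le> real CARD('p) * \<sigma>\<^sup>2"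
proof -
  have "(LINT \<omega>|M. (norm (noise k (seeds \<omega>)))\<^sup>2) = (\<Sum>i\<in>UNIV. LINT \<omega>|M. (norm (noise k (seeds \<omega>) $ i))\<^sup>2)"
    unfolding power2_norm_vec[where 'b = "real^'n"] by (intro Bochner_Integration.integral_sum noise_component)
  also have "\<dots> \<le> (\<Sum>i\<in>(UNIV :: 'p set). \<sigma>\<^sup>2)" by (intro sum_mono noise_component)
  finally show ?thesis by simp
qed

text \<open>The inner product of profiles is a sum over players, and each coordinate of
  \<open>H\<close> is square integrable as it is dominated by \<open>H\<close>; the claim then
  follows player by player.\<close>

lemma noise_orthogonal:
  fixes H :: "_ \<Rightarrow> (real^'n)^'p"
  assumes H[measurable]: "H \<in> borel_measurable (PiM ({..<k} \<times> UNIV) (\<lambda>_. R))"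
    and int: "integrable M (\<lambda>\<omega>. (norm (H (past k \<omega>)))\<^sup>2)"
  shows "integrable M (\<lambda>\<omega>. H (past k \<omega>) \<bullet> noise k (seeds \<omega>))"
    and "(LINT \<omega>|M. H (past k \<omega>) \<bullet> noise k (seeds \<omega>)) = 0"
proof -
  note past_measurable[measurable]
  have "integrable M (\<lambda>\<omega>. (norm (H (past k \<omega>) $ i))\<^sup>2)" for i
    by (rule Bochner_Integration.integrable_bound[OF int])
      (auto intro!: AE_I2 power_mono Finite_Cartesian_Product.norm_nth_le)
  then have *: "integrable M (\<lambda>\<omega>. H (past k \<omega>) $ i \<bullet> noise k (seeds \<omega>) $ i) \<and>
      (LINT \<omega>|M. H (past k \<omega>) $ i \<bullet> noise k (seeds \<omega>) $ i) = 0" for i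
    by (intro noise_component(3)[where Z = "\<lambda>s. H s $ i"]) auto
  have inner: "H (past k \<omega>) \<bullet> noise k (seeds \<omega>)
      = (\<Sum>i\<in>UNIV. H (past k \<omega>) $ i \<bullet> noise k (seeds \<omega>) $ i)" for \<omega>
    by (rule inner_vec_def)
  show "integrable M (\<lambda>\<omega>. H (past k \<omega>) \<bullet> noise k (seeds \<omega>))"
    unfolding inner using * by (intro Bochner_Integration.integrable_sum) blast
  show "(LINT \<omega>|M. H (past k \<omega>) \<bullet> noise k (seeds \<omega>)) = 0"
    unfolding inner using * by (subst Bochner_Integration.integral_sum) auto
qed

section \<open>Second moments of decisions and deviations\<close>

lemma decision_square_integrable: "integrable M (\<lambda>\<omega>. (norm (decision k (seeds \<omega>) - xs))\<^sup>2)"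
proof -
  obtain b where "b \<ge> 0" "\<And>k s. norm (decision k s - xs) \<le> b" using decision_bounded by blast
  then show ?thesis
    by (intro integrable_const_bound[where B = "b\<^sup>2"] AE_I2) (auto intro: power_mono)
qed

lemma drift_square_integrable:
  assumes "integrable M (\<lambda>\<omega>. (norm (deviation k (seeds \<omega>)))\<^sup>2)"
  shows "integrable M (\<lambda>\<omega>. (norm (drift k (seeds \<omega>)))\<^sup>2)"
proof -
  have lin: "linear (\<lambda>v :: (real^'n)^'p. v + \<beta> k *\<^sub>R diffusion w v)"
    by (intro linear_compose_add linear_compose_scale_right diffusion_linear linear_id[unfolded id_def])
  \<comment> \<open>Written as a combination of two bounded distances to \<open>xs\<close>, the
    increment is square integrable for every \<open>k\<close>, including 0, where
    \<open>decision_increment\<close> does not apply.\<close>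
  have "integrable M (\<lambda>\<omega>. (norm ((decision (Suc k) (seeds \<omega>) - xs) + (-1) *\<^sub>R (decision k (seeds \<omega>) - xs)))\<^sup>2)"
    by (intro square_integrable_add square_integrable_linear[where h = "\<lambda>v. (-1) *\<^sub>R v"]
        linear_compose_scale_right linear_id[unfolded id_def] decision_square_integrable) measurable
  then have "integrable M (\<lambda>\<omega>. (norm (decision (Suc k) (seeds \<omega>) - decision k (seeds \<omega>)))\<^sup>2)"
    by simp
  then have d: "integrable M (\<lambda>\<omega>. (norm (disagreement (decision (Suc k) (seeds \<omega>) - decision k (seeds \<omega>))))\<^sup>2)"
    by (intro square_integrable_linear[OF disagreement_linear]) auto
  have l: "integrable M (\<lambda>\<omega>. (norm (deviation k (seeds \<omega>) + \<beta> k *\<^sub>R diffusion w (deviation k (seeds \<omega>))))\<^sup>2)"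
    using assms by (intro square_integrable_linear[OF lin]) auto
  show ?thesis
    unfolding drift_def
    by (rule square_integrable_add[OF borel_measurable_linear[OF lin]
        borel_measurable_linear[OF disagreement_linear] l d]) auto
qed

lemma scaled_diffusion_linear: "linear (\<lambda>v. b *\<^sub>R diffusion w v)"
  by (intro linear_compose_scale_right diffusion_linear)

text \<open>Finiteness is proved by induction from iteration 0, since the contraction holds only for
  late \<open>k\<close>. Without it the integral inequalities below could not be derived from
  pointwise ones.\<close>

lemma deviation_square_integrable: "integrable M (\<lambda>\<omega>. (norm (deviation k (seeds \<omega>)))\<^sup>2)"
proof (induction k)
  case 0
  show ?case by (simp add: deviation_def estimate_0)
next
  case (Suc k)
  have "integrable M (\<lambda>\<omega>. (norm (\<beta> k *\<^sub>R diffusion w (noise k (seeds \<omega>))))\<^sup>2)"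
    by (intro square_integrable_linear[OF scaled_diffusion_linear] noise_square_integrable) measurable
  then show ?case
    unfolding deviation_Suc
    by (intro square_integrable_add drift_square_integrable[OF Suc]
        borel_measurable_linear[OF scaled_diffusion_linear]) auto
qed

text \<open>Expanding the square of drift plus noise, the cross term has mean zero, and the noise
  contributes at most its variance times the squared operator bound of the scaled diffusion.\<close>

lemma deviation_second_moment:
  obtains c where "c \<ge> 0"
    "\<And>k. (LINT \<omega>|M. (norm (deviation (Suc k) (seeds \<omega>)))\<^sup>2)
       \<le> (LINT \<omega>|M. (norm (drift k (seeds \<omega>)))\<^sup>2) + c * (\<beta> k)\<^sup>2"
proof -
  obtain K where K: "K > 0" "\<And>v :: (real^'n)^'p. norm (diffusion w v) \<le> K * norm v"
    using linear_bounded_pos[OF diffusion_linear] by blast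
  have "(LINT \<omega>|M. (norm (deviation (Suc k) (seeds \<omega>)))\<^sup>2)
      \<le> (LINT \<omega>|M. (norm (drift k (seeds \<omega>)))\<^sup>2) + K\<^sup>2 * (real CARD('p) * \<sigma>\<^sup>2) * (\<beta> k)\<^sup>2" for k
  proof -
    let ?u = "\<lambda>\<omega>. drift k (seeds \<omega>)" and ?e = "\<lambda>\<omega>. noise k (seeds \<omega>)"
    let ?H = "\<lambda>s. diffusion w (drift k s)"
    have u: "integrable M (\<lambda>\<omega>. (norm (?u \<omega>))\<^sup>2)"
      by (rule drift_square_integrable[OF deviation_square_integrable])
    \<comment> \<open>Self-adjointness moves the diffusion from the noise onto the drift, a function
      of the past, so that \<open>noise_orthogonal\<close> applies.\<close>
    have "integrable M (\<lambda>\<omega>. (norm (?H (past k \<omega>)))\<^sup>2)"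
      unfolding drift_past by (rule square_integrable_linear[OF diffusion_linear _ u]) measurable
    from noise_orthogonal[OF borel_measurable_linear[OF diffusion_linear drift_past_measurable] this]
    have orth: "integrable M (\<lambda>\<omega>. ?u \<omega> \<bullet> diffusion w (?e \<omega>))"
        "(LINT \<omega>|M. ?u \<omega> \<bullet> diffusion w (?e \<omega>)) = 0"
      by (simp_all add: drift_past diffusion_symmetric[OF graph(1)])
    have e: "integrable M (\<lambda>\<omega>. (norm (?e \<omega>))\<^sup>2)" by (rule noise_square_integrable)
    have "(LINT \<omega>|M. (norm (deviation (Suc k) (seeds \<omega>)))\<^sup>2)
        \<le> (LINT \<omega>|M. (norm (?u \<omega>))\<^sup>2 + 2 * \<beta> k * (?u \<omega> \<bullet> diffusion w (?e \<omega>)) + (\<beta> k)\<^sup>2 * K\<^sup>2 * (norm (?e \<omega>))\<^sup>2)"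
    proof (rule integral_mono)
      fix \<omega>
      have "(norm (deviation (Suc k) (seeds \<omega>)))\<^sup>2
          = (norm (?u \<omega>))\<^sup>2 + 2 * \<beta> k * (?u \<omega> \<bullet> diffusion w (?e \<omega>)) + (\<beta> k)\<^sup>2 * (norm (diffusion w (?e \<omega>)))\<^sup>2"
        unfolding deviation_Suc power2_norm_eq_inner
        by (simp add: inner_add_left inner_add_right inner_commute power2_eq_square)
      moreover have "(\<beta> k)\<^sup>2 * (norm (diffusion w (?e \<omega>)))\<^sup>2 \<le> (\<beta> k)\<^sup>2 * (K * norm (?e \<omega>))\<^sup>2"
        by (intro mult_left_mono power_mono K) auto
      ultimately show "(norm (deviation (Suc k) (seeds \<omega>)))\<^sup>2
          \<le> (norm (?u \<omega>))\<^sup>2 + 2 * \<beta> k * (?u \<omega> \<bullet> diffusion w (?e \<omega>)) + (\<beta> k)\<^sup>2 * K\<^sup>2 * (norm (?e \<omega>))\<^sup>2"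
        by (simp add: power_mult_distrib)
    qed (use u e orth deviation_square_integrable in auto)
    also have "\<dots> = (LINT \<omega>|M. (norm (?u \<omega>))\<^sup>2) + (\<beta> k)\<^sup>2 * K\<^sup>2 * (LINT \<omega>|M. (norm (?e \<omega>))\<^sup>2)"
      using u e orth by simp
    also have "\<dots> \<le> (LINT \<omega>|M. (norm (?u \<omega>))\<^sup>2) + (\<beta> k)\<^sup>2 * K\<^sup>2 * (real CARD('p) * \<sigma>\<^sup>2)"
      by (intro add_left_mono mult_left_mono noise_variance) auto
    finally show ?thesis by (simp add: mult_ac)
  qed
  then show ?thesis by (intro that[of "K\<^sup>2 * (real CARD('p) * \<sigma>\<^sup>2)"]) auto
qed

section \<open>Summable disagreement and mean-square convergence\<close>

lemma summable_deviation: "summable (\<lambda>k. \<beta> k * (LINT \<omega>|M. (norm (deviation k (seeds \<omega>)))\<^sup>2))"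
proof -
  let ?D = "\<lambda>k. LINT \<omega>|M. (norm (deviation k (seeds \<omega>)))\<^sup>2"
  obtain c \<mu> where c: "c \<ge> 0" "\<mu> > 0" and ev: "\<forall>\<^sub>F k in sequentially. \<forall>s.
       (norm (drift k s))\<^sup>2 + \<beta> k * \<mu> * (norm (deviation k s))\<^sup>2
         \<le> (norm (deviation k s))\<^sup>2 + c * ((\<alpha> k)\<^sup>2 * \<beta> k)"
    by (rule drift_contraction)
  from ev obtain K where K: "\<And>k s. k \<ge> K \<Longrightarrow>
       (norm (drift k s))\<^sup>2 + \<beta> k * \<mu> * (norm (deviation k s))\<^sup>2
         \<le> (norm (deviation k s))\<^sup>2 + c * ((\<alpha> k)\<^sup>2 * \<beta> k)"
    unfolding eventually_sequentially by blast
  obtain c' where c': "c' \<ge> 0" and mom: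
    "\<And>k. ?D (Suc k) \<le> (LINT \<omega>|M. (norm (drift k (seeds \<omega>)))\<^sup>2) + c' * (\<beta> k)\<^sup>2"
    using deviation_second_moment by blast
  \<comment> \<open>The contraction in expectation plus the noise variance has the telescoping form;
    its perturbation is summable by the step-size conditions on
    \<open>(\<alpha> k)\<^sup>2 * \<beta> k\<close> and \<open>(\<beta> k)\<^sup>2\<close>.\<close>
  have "summable (\<lambda>k. \<beta> k * \<mu> * ?D k)"
  proof (rule summable_of_decrease)
    fix k assume "k \<ge> K"
    have int: "integrable M (\<lambda>\<omega>. (norm (deviation k (seeds \<omega>)))\<^sup>2)" "integrable M (\<lambda>\<omega>. (norm (drift k (seeds \<omega>)))\<^sup>2)"
      by (intro deviation_square_integrable drift_square_integrable)+
    have "(LINT \<omega>|M. (norm (drift k (seeds \<omega>)))\<^sup>2) + \<beta> k * \<mu> * ?D k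
        = (LINT \<omega>|M. (norm (drift k (seeds \<omega>)))\<^sup>2 + \<beta> k * \<mu> * (norm (deviation k (seeds \<omega>)))\<^sup>2)"
      using int by simp
    also have "\<dots> \<le> (LINT \<omega>|M. (norm (deviation k (seeds \<omega>)))\<^sup>2 + c * ((\<alpha> k)\<^sup>2 * \<beta> k))"
      using int K[OF \<open>k \<ge> K\<close>] by (intro integral_mono) auto
    also have "\<dots> = ?D k + c * ((\<alpha> k)\<^sup>2 * \<beta> k)"
      using int by (simp add: prob_space)
    finally show "?D (Suc k) + \<beta> k * \<mu> * ?D k \<le> ?D k + (c * ((\<alpha> k)\<^sup>2 * \<beta> k) + c' * (\<beta> k)\<^sup>2)"
      using mom[of k] by simp
  next
    show "summable (\<lambda>k. c * ((\<alpha> k)\<^sup>2 * \<beta> k) + c' * (\<beta> k)\<^sup>2)"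
      by (intro summable_add summable_mult step_sum)
  qed (use c c' step_pos in \<open>auto simp: less_imp_le\<close>)
  then have "summable (\<lambda>k. inverse \<mu> * (\<beta> k * \<mu> * ?D k))" by (rule summable_mult)
  then show ?thesis using c(2) by (simp add: field_simps)
qed

lemma mean_square_convergence: "(\<lambda>k. LINT \<omega>|M. (norm (decision k (seeds \<omega>) - xs))\<^sup>2) \<longlonglongrightarrow> 0"
proof -
  let ?D = "\<lambda>k. LINT \<omega>|M. (norm (deviation k (seeds \<omega>)))\<^sup>2"
  let ?E = "\<lambda>k. LINT \<omega>|M. (norm (decision k (seeds \<omega>) - xs))\<^sup>2"
  obtain c where c: "c \<ge> 0" and ev: "\<forall>\<^sub>F k in sequentially. \<forall>s.
       (norm (decision (Suc k) s - xs))\<^sup>2 + 2 * m * (\<alpha> k * \<beta> k) * (norm (decision k s - xs))\<^sup>2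
         \<le> (norm (decision k s - xs))\<^sup>2 + c * ((\<alpha> k)\<^sup>2 * \<beta> k + \<beta> k * (norm (deviation k s))\<^sup>2)"
    by (rule equilibrium_contraction)
  from ev obtain K where K: "\<And>k s. k \<ge> K \<Longrightarrow>
       (norm (decision (Suc k) s - xs))\<^sup>2 + 2 * m * (\<alpha> k * \<beta> k) * (norm (decision k s - xs))\<^sup>2
         \<le> (norm (decision k s - xs))\<^sup>2 + c * ((\<alpha> k)\<^sup>2 * \<beta> k + \<beta> k * (norm (deviation k s))\<^sup>2)"
    unfolding eventually_sequentially by blast
  show ?thesis
  \<comment> \<open>The rate is \<open>2 * m * (\<alpha> k * \<beta> k)\<close>, whose sum diverges;
    the perturbation is summable by \<open>summable_deviation\<close>.\<close>
  proof (rule tendsto_zero_of_decrease)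
    fix k assume "k \<ge> K"
    note int = decision_square_integrable deviation_square_integrable[of k]
    have "?E (Suc k) + 2 * m * (\<alpha> k * \<beta> k) * ?E k
        = (LINT \<omega>|M. (norm (decision (Suc k) (seeds \<omega>) - xs))\<^sup>2
             + 2 * m * (\<alpha> k * \<beta> k) * (norm (decision k (seeds \<omega>) - xs))\<^sup>2)"
      using int by simp
    also have "\<dots> \<le> (LINT \<omega>|M. (norm (decision k (seeds \<omega>) - xs))\<^sup>2
          + c * ((\<alpha> k)\<^sup>2 * \<beta> k + \<beta> k * (norm (deviation k (seeds \<omega>)))\<^sup>2))"
      using int K[OF \<open>k \<ge> K\<close>] by (intro integral_mono) auto
    also have "\<dots> = ?E k + c * ((\<alpha> k)\<^sup>2 * \<beta> k + \<beta> k * ?D k)"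
      using int by (simp add: prob_space)
    finally show "?E (Suc k) + 2 * m * (\<alpha> k * \<beta> k) * ?E k \<le> ?E k + c * ((\<alpha> k)\<^sup>2 * \<beta> k + \<beta> k * ?D k)" .
  next
    show "summable (\<lambda>k. c * ((\<alpha> k)\<^sup>2 * \<beta> k + \<beta> k * ?D k))"
      by (intro summable_mult summable_add step_sum summable_deviation)
    show "\<not> summable (\<lambda>k. 2 * m * (\<alpha> k * \<beta> k))"
    proof
      assume "summable (\<lambda>k. 2 * m * (\<alpha> k * \<beta> k))"
      then have s: "summable (\<lambda>k. \<alpha> k * \<beta> k)" using m by (simp add: summable_cmult_iff)
      \<comment> \<open>For positive terms summability would bound the partial sums by the total,
        against their divergence.\<close>
      have "(\<Sum>k<n. \<alpha> k * \<beta> k) \<le> suminf (\<lambda>k. \<alpha> k * \<beta> k)" for n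
        using step_pos by (intro sum_le_suminf[OF s]) (auto simp: less_imp_le)
      moreover have "\<forall>\<^sub>F n in sequentially. suminf (\<lambda>k. \<alpha> k * \<beta> k) < (\<Sum>k<n. \<alpha> k * \<beta> k)"
        using step_div by (simp add: filterlim_at_top_dense)
      ultimately show False
        by (auto simp: eventually_sequentially not_less[symmetric])
    qed
  qed (use c m step_pos in \<open>auto simp: less_imp_le\<close>)
qed

end

theorem theorem1:
  fixes X :: "'p::finite \<Rightarrow> (real^'n) set"
    and f :: "'p \<Rightarrow> real^'n \<Rightarrow> real^'n \<Rightarrow> real"
    and w :: "'p \<Rightarrow> 'p \<Rightarrow> real"
    and \<alpha> \<beta> :: "nat \<Rightarrow> real"
    and x0 xs :: "(real^'n)^'p"
    and M :: "'w measure" and R :: "'r measure"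
    and C :: "'r \<Rightarrow> real^'n \<Rightarrow> real^'n"
    and \<xi> :: "nat \<Rightarrow> 'p \<Rightarrow> 'w \<Rightarrow> 'r"
    and L\<^sub>\<phi> L\<^sub>g m B \<sigma> :: real
  assumes X: "\<And>i. bounded (X i) \<and> closed (X i) \<and> convex (X i)"
    and graph: "undirected_weights w" "connected_weights w"
    and f_convex: "\<And>i z. (\<And>j. j \<noteq> i \<Longrightarrow> z $ j \<in> X j) \<Longrightarrow>
          convex_on (X i) (\<lambda>u. f i u (aggregate (deviate z i u)))"
    and f_C1: "\<And>i. cont_differentiable_on (\<lambda>(u, v). f i u v) (X i \<times> UNIV)"
    and xs: "nash_equilibrium X f xs"
    and phi_Lipschitz: "\<And>i x y. norm (phi f i x - phi f i y) \<le> L\<^sub>\<phi> * norm (x - y)"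
    and m: "m > 0"
    and strong_mono: "\<And>x. (x - xs) \<bullet> (Phi f x - Phi f xs) \<ge> m * (norm (x - xs))\<^sup>2"
    and g_Lipschitz: "\<And>i u z1 z2. u \<in> X i \<Longrightarrow>
          norm (g_fun f i u z1 - g_fun f i u z2) \<le> L\<^sub>g * norm (z1 - z2)"
    and B: "B > 0"
    and g_bound: "\<And>i u z. u \<in> X i \<Longrightarrow> norm (g_fun f i u z) \<le> B"
    and phi_bound: "\<And>i x. x \<in> profiles X \<Longrightarrow> norm (phi f i x) \<le> B"
    and M: "prob_space M"
    and compression: "unbiased_compression M R C \<xi> \<sigma>"
    and step_pos: "\<And>k. \<alpha> k > 0" "\<And>k. \<beta> k > 0"
    and step_div: "filterlim (\<lambda>n. \<Sum>k<n. \<alpha> k * \<beta> k) at_top sequentially"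
    and step_sum: "summable (\<lambda>k. (\<alpha> k)\<^sup>2 * \<beta> k)" "summable (\<lambda>k. (\<beta> k)\<^sup>2)"
  shows "(\<forall>k. integrable M (\<lambda>\<omega>. (norm (cp_dnes_x X f w \<alpha> \<beta> C \<xi> x0 k \<omega> - xs))\<^sup>2)) \<and>
         (\<lambda>k. LINT \<omega>|M. (norm (cp_dnes_x X f w \<alpha> \<beta> C \<xi> x0 k \<omega> - xs))\<^sup>2) \<longlonglongrightarrow> 0"
proof -
  interpret prob_space M by (rule M)
  interpret cp_dnes_run M X f w \<alpha> \<beta> x0 xs R C \<xi> L\<^sub>g m B \<sigma>
    by unfold_locales (rule X graph f_C1 xs m strong_mono g_Lipschitz g_bound compression
      step_pos step_div step_sum; assumption?)+
  \<comment> \<open>The random trajectory is the deterministic one evaluated at the realised seeds,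
    which transfers the results of the locale.\<close>
  have "cp_dnes_x X f w \<alpha> \<beta> C \<xi> x0 k \<omega> = decision k (seeds \<omega>)" for k \<omega>
    by (simp add: cp_dnes_x_def decision_def state_def seeds_def)
  then show ?thesis
    using decision_square_integrable mean_square_convergence by simp
qed

end
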